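(* Let $L$ be any classical problem and let $R$ be a parameterized problem. If there exists an oracle OR distillation from $L$ into $R$, then $L\in\mathrm{coNP}/\mathrm{poly}$.
   Context: A classical problem is a subset of $\{0,1\}^*$; a parameterized problem is a subset of $\{0,1\}^*\times\mathbb{N}$, and for an instance $(y,p)$, $|(y,p)|:=|y|+p+c_0$ for a fixed constant $c_0$. An oracle OR distillation of $L$ into $R$ is an algorithm $\mathcal{A}$ with oracle access to $R$ such that there is some $\varepsilon>0$ for which, given any sequence of instances $x_1,\dots,x_t$ of $L$, $\mathcal{A}$ uses oracle queries $(y_1,p_1),\dots,(y_s,p_s)$ to $R$ of total size $\sum_{i=1}^s|(y_i,p_i)|$ bounded by $t^{1-\varepsilon}\,\mathrm{poly}(\max_i|x_i|)$, and returns "Yes" if and only if $x_i\in L$ for at least one $i$.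
   Formalization: The algorithm in an oracle OR distillation is required to run in time polynomial in the total length of the instances; with no time bound the claim fails, since any decidable L outside coNP/poly has a distillation that asks no queries. *)

theory Defs
  imports "HOL-Computational_Algebra.Polynomial"
begin

section \<open>Nondeterministic multi-tape Turing machines\<close>

datatype sym = Blank | Zero | One | Sep | Aux nat

datatype move = Left | Stay | Right

text \<open>Tapes are infinite to the right only; a left move on cell \<open>0\<close> leaves the head where it is
  (truncated subtraction in \<open>act\<close>).\<close>

type_synonym tape = "(nat \<Rightarrow> sym) \<times> nat"
type_synonym 'q config = "'q \<times> tape list"

text \<open>A transition \<open>(q, r, q', a)\<close> applies in state \<open>q\<close> when the heads read \<open>r\<close>; it enters \<open>q'\<close> and
  performs the write and move actions \<open>a\<close>. Since \<open>trans\<close> is required to be finite, a machine uses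
  only finitely many states and symbols.\<close>

record 'q tm =
  tapes :: nat
  start :: 'q
  accept :: 'q
  trans :: "('q \<times> sym list \<times> 'q \<times> (sym \<times> move) list) set"

definition wf_tm :: "('q, 'm) tm_scheme \<Rightarrow> bool" where
  "wf_tm M \<longleftrightarrow> tapes M \<ge> 1 \<and> finite (trans M) \<and>
    (\<forall>(q, r, q', a) \<in> trans M. length r = tapes M \<and> length a = tapes M)"

fun read :: "tape \<Rightarrow> sym" where
  "read (f, i) = f i"

fun act :: "sym \<times> move \<Rightarrow> tape \<Rightarrow> tape" where
  "act (s, d) (f, i) = (f(i := s), case d of Left \<Rightarrow> i - 1 | Stay \<Rightarrow> i | Right \<Rightarrow> i + 1)"

fun step :: "('q, 'm) tm_scheme \<Rightarrow> 'q config \<Rightarrow> 'q config \<Rightarrow> bool" where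
  "step M (q, ts) (q', ts') \<longleftrightarrow>
    (\<exists>a. (q, map read ts, q', a) \<in> trans M \<and> ts' = map2 act a ts)"

definition tape_of :: "sym list \<Rightarrow> tape" where
  "tape_of w = (\<lambda>i. if i < length w then w ! i else Blank, 0)"

definition init :: "('q, 'm) tm_scheme \<Rightarrow> sym list \<Rightarrow> 'q config" where
  "init M w = (start M, tape_of w # replicate (tapes M - 1) (tape_of []))"

definition accepts :: "('q, 'm) tm_scheme \<Rightarrow> sym list \<Rightarrow> bool" where
  "accepts M w \<longleftrightarrow>
    (\<exists>c. (step M)\<^sup>*\<^sup>* (init M w) c \<and> (\<nexists>c'. step M c c') \<and> fst c = accept M)"

definition halts_within :: "('q, 'm) tm_scheme \<Rightarrow> sym list \<Rightarrow> nat \<Rightarrow> bool" where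
  "halts_within M w T \<longleftrightarrow> (\<forall>n c. (step M ^^ n) (init M w) c \<longrightarrow> n \<le> T)"


section \<open>Complexity classes\<close>

type_synonym problem = "bool list set"

definition bits :: "bool list \<Rightarrow> sym list" where
  "bits x = map (\<lambda>b. if b then One else Zero) x"

definition NP :: "problem set" where
  "NP = {L. \<exists>(M :: nat tm) (p :: nat poly). wf_tm M \<and>
    (\<forall>x. halts_within M (bits x) (poly p (length x)) \<and> (x \<in> L \<longleftrightarrow> accepts M (bits x)))}"

definition coNP :: "problem set" where
  "coNP = {L. - L \<in> NP}"

text \<open>Every bit of the first component is doubled, so the first aligned block \<open>01\<close> marks its end.\<close>

definition pair :: "bool list \<Rightarrow> bool list \<Rightarrow> bool list" where
  "pair x y = concat (map (\<lambda>b. [b, b]) x) @ [False, True] @ y"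

definition slash_poly :: "problem set \<Rightarrow> problem set" where
  "slash_poly C = {L. \<exists>A \<in> C. \<exists>(adv :: nat \<Rightarrow> bool list) (p :: nat poly).
    (\<forall>n. length (adv n) \<le> poly p n) \<and> (\<forall>x. x \<in> L \<longleftrightarrow> pair x (adv (length x)) \<in> A)}"


section \<open>Oracle machines\<close>

text \<open>Tape \<open>1\<close> is the query tape. In state \<open>query\<close> the machine moves, in a single step, to state
  \<open>yes\<close> or \<open>no\<close> according to whether the word on the query tape belongs to the oracle; the tapes and
  heads are unchanged.\<close>

record 'q oracle_tm = "'q tm" +
  query :: 'q
  yes :: 'q
  no :: 'q

definition wf_oracle_tm :: "('q, 'm) oracle_tm_scheme \<Rightarrow> bool" where
  "wf_oracle_tm M \<longleftrightarrow> wf_tm M \<and> tapes M \<ge> 2"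

definition deterministic :: "('q, 'm) tm_scheme \<Rightarrow> bool" where
  "deterministic M \<longleftrightarrow>
    (\<forall>q r q1 a1 q2 a2. (q, r, q1, a1) \<in> trans M \<and> (q, r, q2, a2) \<in> trans M \<longrightarrow>
      q1 = q2 \<and> a1 = a2)"

text \<open>The word from cell \<open>0\<close> up to the first blank; a tape that occurs in a computation has only
  finitely many non-blank cells.\<close>

definition word_on :: "tape \<Rightarrow> sym list" where
  "word_on t = map (fst t) [0..<(LEAST i. fst t i = Blank)]"

text \<open>\<open>oracle_run M Q c n qs c'\<close>: with oracle \<open>Q\<close>, the machine gets from \<open>c\<close> to \<open>c'\<close> in \<open>n\<close> steps,
  asking the queries \<open>qs\<close> in this order.\<close>

inductive oracle_run ::
  "('q, 'm) oracle_tm_scheme \<Rightarrow> sym list set \<Rightarrow> 'q config \<Rightarrow> nat \<Rightarrow> sym list list \<Rightarrow> 'q config \<Rightarrow> bool"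
  for M Q where
  refl: "oracle_run M Q c 0 [] c"
| compute: "fst c \<noteq> query M \<Longrightarrow> step M c c' \<Longrightarrow> oracle_run M Q c' n qs c'' \<Longrightarrow>
    oracle_run M Q c (Suc n) qs c''"
| ask: "w = word_on (ts ! 1) \<Longrightarrow>
    oracle_run M Q (if w \<in> Q then yes M else no M, ts) n qs c'' \<Longrightarrow>
    oracle_run M Q (query M, ts) (Suc n) (w # qs) c''"

definition oracle_halted :: "('q, 'm) oracle_tm_scheme \<Rightarrow> 'q config \<Rightarrow> bool" where
  "oracle_halted M c \<longleftrightarrow> fst c \<noteq> query M \<and> (\<nexists>c'. step M c c')"


section \<open>Oracle OR distillations\<close>

type_synonym inst = "bool list \<times> nat"
type_synonym parameterized_problem = "inst set"

definition inst_size :: "nat \<Rightarrow> inst \<Rightarrow> nat" where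
  "inst_size c\<^sub>0 = (\<lambda>(y, p). length y + p + c\<^sub>0)"

definition enc_inst :: "inst \<Rightarrow> sym list" where
  "enc_inst = (\<lambda>(y, p). bits y @ [Sep] @ replicate p One)"

definition enc_seq :: "bool list list \<Rightarrow> sym list" where
  "enc_seq xs = concat (map (\<lambda>x. bits x @ [Sep]) xs)"

text \<open>The algorithm is a deterministic machine that, with oracle \<open>R\<close>, runs in time polynomial in its
  whole input; every word it asks must encode an instance of \<open>R\<close>.\<close>

definition oracle_or_distillation ::
  "nat \<Rightarrow> ('q, 'm) oracle_tm_scheme \<Rightarrow> problem \<Rightarrow> parameterized_problem \<Rightarrow> bool" where
  "oracle_or_distillation c\<^sub>0 M L R \<longleftrightarrow> wf_oracle_tm M \<and> deterministic M \<and>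
    (\<exists>(\<epsilon> :: real) > 0. \<exists>(time :: nat poly) (b :: nat poly). \<forall>xs. xs \<noteq> [] \<longrightarrow>
      (\<exists>n ys c.
        oracle_run M (enc_inst ` R) (init M (enc_seq xs)) n (map enc_inst ys) c \<and>
        oracle_halted M c \<and>
        n \<le> poly time (length (enc_seq xs)) \<and>
        real (\<Sum>y\<leftarrow>ys. inst_size c\<^sub>0 y)
          \<le> real (length xs) powr (1 - \<epsilon>) * real (poly b (Max (length ` set xs))) \<and>
        (fst c = accept M \<longleftrightarrow> (\<exists>x \<in> set xs. x \<in> L))))"

end

theory Submission
  imports Defs "HOL-Library.Countable"
begin

text \<open>Fix a length \<open>n\<close> and take tuples of \<open>t\<close> words of length \<open>n\<close> outside \<open>L\<close>, where \<open>t\<close> is a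
  polynomial in \<open>n\<close> so large that the queries asked on such a tuple can be written down with
  \<open>t\<close> bits. By the pigeonhole principle some query list is asked on so many tuples that their
  components make up at least half of all words outside \<open>L\<close>; iterating, \<open>n + 1\<close> query lists suffice
  for every \<open>x \<notin> L\<close> to be a component of a tuple whose queries are all among them. The advice is the
  table of these queries with their true answers. Given \<open>x\<close>, a nondeterministic machine guesses a
  tuple containing \<open>x\<close>, runs the distillation with the oracle replaced by table lookups, and accepts
  if it ends with ``No''. Every answer used is true, so no \<open>x \<in> L\<close> is accepted.

  The machine reads its input tape in one direction, one cell per step, hence it halts on
  every input; the advice is padded so that the computation has enough time.\<close>

text \<open>\<open>NP\<close> demands halting in polynomial time on every input, malformed advice
  included, and for all nondeterministic choices. With one input bit spent per step this needs no
  programmed clock, and heads may wander freely while an entry or a mark is sought: a bad choice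
  only wastes bits. In return, time is bought with advice bits, so the completeness direction needs
  explicit step bounds.

  The two directions use the distillation differently. Covering takes tuples of words of one length
  \<open>n\<close>, so that the bound on the query size depends on \<open>t\<close> and
  \<open>n\<close> only. Soundness uses correctness on every sequence that contains
  \<open>x\<close>, since nothing restricts the other guessed components; a guess whose query is
  missing from the table never reaches acceptance. Determinism of the oracle machine identifies the
  simulated outcome with the promised one.

  The choice is \<open>t = (9 * poly b n + 1) ^ K\<close> with \<open>K\<close> at least
  1/\<epsilon>. Then t^\<epsilon> exceeds 9 * poly b n, so the queries on a tuple weigh at most t/9,
  and there are at most 2^t query lists of that weight.\<close>

declare step.simps [simp del]

section \<open>Renaming the states of a machine\<close>

text \<open>\<open>NP\<close> asks for machines with states of type \<open>nat\<close>, whereas the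
  verifier has the structured state type \<open>vstate\<close>; an injective renaming carries
  halting and acceptance over.\<close>

definition relabel :: "('a \<Rightarrow> 'b) \<Rightarrow> 'a tm \<Rightarrow> 'b tm" where
  "relabel f M = \<lparr>tapes = tapes M, start = f (start M), accept = f (accept M),
     trans = (\<lambda>(q, r, q', a). (f q, r, f q', a)) ` trans M\<rparr>"

lemma step_relabel:
  assumes "inj f"
  shows "step (relabel f M) (f q, ts) c \<longleftrightarrow> (\<exists>q' ts'. c = (f q', ts') \<and> step M (q, ts) (q', ts'))"
  using injD[OF assms] by (cases c) (force simp: relabel_def step.simps)

lemma steps_relabel:
  assumes "inj f"
  shows "(step (relabel f M) ^^ n) (f q, ts) c \<longleftrightarrow>
    (\<exists>q' ts'. c = (f q', ts') \<and> (step M ^^ n) (q, ts) (q', ts'))"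
proof (induction n arbitrary: c)
  case (Suc n)
  show ?case
    by (simp add: relcompp_apply Suc) (use step_relabel[OF assms] in blast)
qed auto

lemma init_relabel: "init (relabel f M) w = (f (start M), snd (init M w))"
  by (simp add: init_def relabel_def)

lemma halts_within_relabel:
  assumes "inj f"
  shows "halts_within (relabel f M) w T \<longleftrightarrow> halts_within M w T"
  unfolding halts_within_def init_relabel steps_relabel[OF assms]
  by (auto simp: init_def)

definition acc_from :: "('q, 'm) tm_scheme \<Rightarrow> 'q config \<Rightarrow> bool" where
  "acc_from M c \<longleftrightarrow> (\<exists>c'. (step M)\<^sup>*\<^sup>* c c' \<and> (\<nexists>c''. step M c' c'') \<and> fst c' = accept M)"

lemma accepts_acc_from: "accepts M w = acc_from M (init M w)"
  by (simp add: accepts_def acc_from_def)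

lemma acc_from_relabel:
  assumes "inj f"
  shows "acc_from (relabel f M) (f q, ts) \<longleftrightarrow> acc_from M (q, ts)"
proof -
  have *: "(step (relabel f M))\<^sup>*\<^sup>* (f q, ts) c \<longleftrightarrow>
      (\<exists>q' ts'. c = (f q', ts') \<and> (step M)\<^sup>*\<^sup>* (q, ts) (q', ts'))" for c
    unfolding rtranclp_power steps_relabel[OF assms] by blast
  have acc: "f q' = accept (relabel f M) \<longleftrightarrow> q' = accept M" for q'
    using injD[OF assms] by (auto simp: relabel_def)
  show ?thesis
  proof
    assume "acc_from (relabel f M) (f q, ts)"
    then obtain q' ts' where "(step M)\<^sup>*\<^sup>* (q, ts) (q', ts')" "q' = accept M"
        "\<nexists>c''. step (relabel f M) (f q', ts') c''"
      unfolding acc_from_def * using acc by fastforce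
    then show "acc_from M (q, ts)"
      unfolding acc_from_def by (metis fst_conv step_relabel[OF assms] surj_pair)
  next
    assume "acc_from M (q, ts)"
    then obtain q' ts' where c: "(step M)\<^sup>*\<^sup>* (q, ts) (q', ts')" "q' = accept M"
        "\<nexists>c''. step M (q', ts') c''"
      unfolding acc_from_def by fastforce
    have "(step (relabel f M))\<^sup>*\<^sup>* (f q, ts) (f q', ts')" using c * by blast
    moreover have "\<nexists>c''. step (relabel f M) (f q', ts') c''"
      using c(3) step_relabel[OF assms] by blast
    ultimately show "acc_from (relabel f M) (f q, ts)"
      unfolding acc_from_def using acc c(2) by fastforce
  qed
qed

lemma accepts_relabel:
  assumes "inj f"
  shows "accepts (relabel f M) w \<longleftrightarrow> accepts M w"
  unfolding accepts_acc_from init_relabel acc_from_relabel[OF assms] by (simp add: init_def)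

lemma wf_relabel: "wf_tm M \<Longrightarrow> wf_tm (relabel f M)"
  unfolding wf_tm_def relabel_def by (simp add: case_prod_beta)

definition det_step :: "('q, 'm) tm_scheme \<Rightarrow> 'q config \<Rightarrow> 'q config \<Rightarrow> bool" where
  "det_step M c c' \<longleftrightarrow> (\<forall>c''. step M c c'' \<longleftrightarrow> c'' = c')"

text \<open>Where the next step is forced, acceptance before and after it are equivalent in both
  directions. This cuts off the whole loading phase at once, for soundness and completeness
  alike.\<close>

lemma acc_from_det_step:
  assumes "det_step M c c'"
  shows "acc_from M c \<longleftrightarrow> acc_from M c'"
proof -
  have s: "step M c c''\<longleftrightarrow> c'' = c'" for c'' using assms unfolding det_step_def by blast
  show ?thesis
  proof
    assume "acc_from M c"
    then obtain d where d: "(step M)\<^sup>*\<^sup>* c d" "\<nexists>c''. step M d c''" "fst d = accept M"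
      by (auto simp: acc_from_def)
    have "c \<noteq> d" using s d(2) by blast
    with d(1) have "(step M)\<^sup>*\<^sup>* c' d" using s by (metis converse_rtranclpE)
    with d show "acc_from M c'" unfolding acc_from_def by blast
  next
    assume "acc_from M c'"
    then show "acc_from M c"
      unfolding acc_from_def by (metis converse_rtranclp_into_rtranclp s)
  qed
qed

lemma acc_from_det_steps: "(det_step M)\<^sup>*\<^sup>* c c' \<Longrightarrow> acc_from M c \<longleftrightarrow> acc_from M c'"
  by (induction rule: rtranclp_induct) (auto dest: acc_from_det_step)

section \<open>Tapes\<close>

definition cont :: "sym list \<Rightarrow> nat \<Rightarrow> sym" where
  "cont w i = (if i < length w then w ! i else Blank)"

lemma tape_of_cont: "tape_of w = (cont w, 0)"
  by (auto simp: tape_of_def cont_def)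

lemma cont_snoc: "(cont w)(length w := s) = cont (w @ [s])"
  by (auto simp: cont_def nth_append)

lemma cont_append [simp]: "cont (u @ s # v) (length u) = s"
  by (simp add: cont_def)

lemma cont_0 [simp]: "cont (s # v) 0 = s"
  by (simp add: cont_def)

lemma cont_upd_same [simp]: "cont w (i) = s \<Longrightarrow> (cont w)(i := s) = cont w"
  by auto

abbreviation stay :: "sym \<Rightarrow> sym \<times> move" where
  "stay s \<equiv> (s, Stay)"

lemma act_stay [simp]: "act (stay (read t)) t = t"
  by (cases t) simp

lemma read_eq: "read t = fst t (snd t)"
  by (cases t) simp

lemma map2_act_stay: "map2 act (map stay (map read ts)) ts = ts"
  by (induction ts) auto

lemma map2_act_upd:
  "i < length ts \<Longrightarrow> map2 act ((map stay (map read ts))[i := a]) ts = ts[i := act a (ts ! i)]"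
  by (rule nth_equalityI) (auto simp: nth_list_update)

section \<open>The verifying machine\<close>

text \<open>The tapes are the input, a work tape \<open>W\<close> for \<open>x\<close>, a tape \<open>C\<close> for the table of answered queries,
  a tape \<open>H\<close> whose head follows that of \<open>M\<close>'s input tape during guessing and that of \<open>M\<close>'s query tape
  afterwards, and then the tapes of \<open>M\<close>. Cell \<open>0\<close> of \<open>W\<close> and \<open>H\<close> carries \<open>Sep\<close>, which makes the left end detectable.

  The phases are: load \<open>x\<close> (\<open>Start\<close>, \<open>Rd\<close>, \<open>Rd2\<close>) and the table (\<open>Ld n\<close>, having read \<open>n\<close> ones); rewind \<open>W\<close>
  (\<open>RW\<close>); guess a tuple, where \<open>G u bd\<close> records whether \<open>x\<close> has been used and whether a component may
  start here, and \<open>Cp\<close> copies \<open>x\<close>; rewind (\<open>RM\<close>); simulate state \<open>q\<close> of \<open>M\<close> (\<open>Run q\<close>). A query marks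
  the head position on \<open>H\<close>, goes to the left end (\<open>QL\<close>), moves \<open>C\<close> to some entry (\<open>QS\<close>), compares (\<open>QC\<close>)
  and returns to the mark with the answer \<open>b\<close> (\<open>QB b\<close>).\<close>

datatype vstate = Start | Rd | Rd2 sym | Ld nat | RW | G bool bool | Cp | RM | Run nat
  | QL | QS | QC | QB bool | Acc

instance move :: countable by countable_datatype
instance sym :: countable by countable_datatype
instance vstate :: countable by countable_datatype

text \<open>The alphabet of the table. The symbol at position \<open>n\<close> is written in the
  advice as \<open>n\<close> ones and a zero; with six symbols, a run of six ones is free to mark
  the end.\<close>

definition csyms :: "sym list" where
  "csyms = [Zero, One, Sep, Aux 0, Aux 1, Aux 2]"

text \<open>Kept apart from \<open>work\<close> because it is deterministic. In state
  \<open>Rd2 i\<close> a second \<open>i\<close> completes a doubled bit of \<open>x\<close>, while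
  the block 01 ends the word; in state \<open>Ld n\<close> a zero emits the symbol with code
  \<open>n\<close>. The end markers on \<open>W\<close> and \<open>H\<close> are laid down while the
  first bit is read.\<close>

inductive load :: "vstate \<Rightarrow> sym \<Rightarrow> sym \<Rightarrow> sym \<Rightarrow> sym \<Rightarrow> vstate \<Rightarrow> sym \<times> move \<Rightarrow> sym \<times> move \<Rightarrow> sym \<times> move \<Rightarrow> bool" where
  "load Start i w c h (Rd2 i) (Sep, Right) (stay c) (stay Sep)"
| "load Rd i w c h (Rd2 i) (stay w) (stay c) (stay h)"
| "load (Rd2 i) i w c h Rd (i, Right) (stay c) (stay h)"
| "load (Rd2 Zero) One w c h (Ld 0) (stay w) (stay c) (stay h)"
| "n < 6 \<Longrightarrow> load (Ld n) One w c h (Ld (Suc n)) (stay w) (stay c) (stay h)"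
| "n < 6 \<Longrightarrow> load (Ld n) Zero w c h (Ld 0) (stay w) (csyms ! n, Right) (stay h)"
| "load (Ld 6) Zero w c h RW (stay w) (stay c) (stay h)"

text \<open>On \<open>H\<close>, \<open>One\<close> and \<open>Zero\<close> are the marked versions of \<open>Blank\<close> and \<open>Sep\<close>.\<close>

fun mark :: "sym \<Rightarrow> sym" where
  "mark Sep = Zero"
| "mark s = One"

fun unmark :: "sym \<Rightarrow> sym" where
  "unmark Zero = Sep"
| "unmark s = Blank"

text \<open>In \<open>QS1\<close> and \<open>QB1\<close> the head wanders freely: no distance has to be counted, because the phase
  can only be left at a cell that certifies the right position.\<close>

inductive work :: "(nat, 'm) oracle_tm_scheme \<Rightarrow> vstate \<Rightarrow> sym \<Rightarrow> sym \<Rightarrow> sym \<Rightarrow> sym list \<Rightarrow>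
    vstate \<Rightarrow> sym \<times> move \<Rightarrow> sym \<times> move \<Rightarrow> sym \<times> move \<Rightarrow> (sym \<times> move) list \<Rightarrow> bool"
  for M where
  RW1: "w \<noteq> Sep \<Longrightarrow> work M RW w c h rs RW (w, Left) (stay c) (stay h) (map stay rs)"
| RW2: "work M RW Sep c h rs (G False True) (Sep, Right) (stay c) (stay h) (map stay rs)"
| G_bit: "s \<in> {Zero, One} \<Longrightarrow>
    work M (G u bd) w c h rs (G u False) (stay w) (stay c) (h, Right) ((map stay rs)[0 := (s, Right)])"
| G_sep: "work M (G u bd) w c h rs (G u True) (stay w) (stay c) (h, Right) ((map stay rs)[0 := (Sep, Right)])"
| G_copy: "work M (G False True) w c h rs Cp (stay w) (stay c) (stay h) (map stay rs)"
| G_end: "work M (G True True) w c h rs RM (stay w) (stay c) (stay h) (map stay rs)"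
| Cp1: "w \<in> {Zero, One} \<Longrightarrow>
    work M Cp w c h rs Cp (w, Right) (stay c) (h, Right) ((map stay rs)[0 := (w, Right)])"
| Cp2: "work M Cp Blank c h rs (G True True) (stay Blank) (stay c) (h, Right) ((map stay rs)[0 := (Sep, Right)])"
| RM1: "h \<noteq> Sep \<Longrightarrow> work M RM w c h rs RM (stay w) (stay c) (h, Left) ((map stay rs)[0 := (rs ! 0, Left)])"
| RM2: "work M RM w c Sep rs (Run (start M)) (stay w) (stay c) (stay Sep) (map stay rs)"
| Run_step: "q \<noteq> query M \<Longrightarrow> (q, rs, q', a) \<in> trans M \<Longrightarrow>
    work M (Run q) w c h rs (Run q') (stay w) (stay c) (h, snd (a ! 1)) a"
| Run_halt: "q \<noteq> query M \<Longrightarrow> q \<noteq> accept M \<Longrightarrow> (\<And>q' a. (q, rs, q', a) \<notin> trans M) \<Longrightarrow>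
    work M (Run q) w c h rs Acc (stay w) (stay c) (stay h) (map stay rs)"
| Run_ask: "work M (Run (query M)) w c h rs QL (stay w) (stay c) (stay (mark h)) (map stay rs)"
| QL1: "h \<notin> {Sep, Zero} \<Longrightarrow>
    work M QL w c h rs QL (stay w) (stay c) (h, Left) ((map stay rs)[1 := (rs ! 1, Left)])"
| QL2: "h \<in> {Sep, Zero} \<Longrightarrow> work M QL w c h rs QS (stay w) (stay c) (stay h) (map stay rs)"
| QS1: "work M QS w c h rs QS (stay w) (c, d) (stay h) (map stay rs)"
| QS2: "work M QS w (Aux 2) h rs QC (stay w) (Aux 2, Right) (stay h) (map stay rs)"
| QC1: "c \<in> {Zero, One, Sep} \<Longrightarrow> rs ! 1 = c \<Longrightarrow>
    work M QC w c h rs QC (stay w) (c, Right) (h, Right) ((map stay rs)[1 := (c, Right)])"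
| QC2: "rs ! 1 = Blank \<Longrightarrow> c = Aux (of_bool b) \<Longrightarrow>
    work M QC w c h rs (QB b) (stay w) (stay c) (stay h) (map stay rs)"
| QB1: "work M (QB b) w c h rs (QB b) (stay w) (stay c) (h, d) ((map stay rs)[1 := (rs ! 1, d)])"
| QB2: "h \<in> {One, Zero} \<Longrightarrow>
    work M (QB b) w c h rs (Run (if b then yes M else no M)) (stay w) (stay c) (stay (unmark h)) (map stay rs)"

definition syms :: "(nat, 'm) oracle_tm_scheme \<Rightarrow> sym set" where
  "syms M = {Blank, Zero, One, Sep, Aux 0, Aux 1, Aux 2} \<union>
     (\<Union>(q, r, q', a) \<in> trans M. set r \<union> fst ` set a)"

definition states :: "(nat, 'm) oracle_tm_scheme \<Rightarrow> vstate set" where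
  "states M = {Start, Rd, RW, Cp, RM, QL, QS, QC, QB True, QB False, Acc, Rd2 Zero, Rd2 One} \<union>
     Ld ` {..6} \<union> (\<Union>u. \<Union>bd. {G u bd}) \<union>
     Run ` ({start M, yes M, no M, query M} \<union> (\<Union>(q, r, q', a) \<in> trans M. {q'}))"

text \<open>Each rule reads a bit, leaves it in place and moves the input head to the right. In the
  working phases the value of that bit is immaterial: the rest of the input only counts the steps
  that are left.\<close>

inductive rule :: "(nat, 'm) oracle_tm_scheme \<Rightarrow> vstate \<Rightarrow> sym list \<Rightarrow> vstate \<Rightarrow> (sym \<times> move) list \<Rightarrow> bool" for M where
  load: "load q i w c h q' aw ac ah \<Longrightarrow> i \<in> {Zero, One} \<Longrightarrow>
    rule M q (i # w # c # h # rs) q' ((i, Right) # aw # ac # ah # map stay rs)"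
| work: "work M q w c h rs q' aw ac ah as \<Longrightarrow> i \<in> {Zero, One} \<Longrightarrow>
    rule M q (i # w # c # h # rs) q' ((i, Right) # aw # ac # ah # as)"

text \<open>The explicit bounds on states and symbols only serve to make the transition set finite.\<close>

definition verifier :: "(nat, 'm) oracle_tm_scheme \<Rightarrow> vstate tm" where
  "verifier M = \<lparr>tapes = tapes M + 4, start = Start, accept = Acc,
     trans = {(q, r, q', a). q \<in> states M \<and> q' \<in> states M \<and>
       (set r \<subseteq> syms M \<and> length r = tapes M + 4) \<and>
       (set a \<subseteq> syms M \<times> {Left, Stay, Right} \<and> length a = tapes M + 4) \<and> rule M q r q' a}\<rparr>"

section \<open>Finiteness of the verifier and closure of its states and symbols\<close>

lemma finite_syms: "wf_tm M \<Longrightarrow> finite (syms M)"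
  by (auto simp: syms_def wf_tm_def)

lemma finite_states: "wf_tm M \<Longrightarrow> finite (states M)"
  by (auto simp: states_def wf_tm_def)

lemma wf_verifier:
  assumes "wf_tm M"
  shows "wf_tm (verifier M)"
proof -
  let ?R = "{r. set r \<subseteq> syms M \<and> length r = tapes M + 4}"
  let ?A = "{a. set a \<subseteq> syms M \<times> {Left, Stay, Right} \<and> length a = tapes M + 4}"
  have "trans (verifier M) \<subseteq> states M \<times> ?R \<times> states M \<times> ?A"
    by (auto simp: verifier_def)
  moreover have "finite (states M \<times> ?R \<times> states M \<times> ?A)"
    using assms by (intro finite_cartesian_product finite_lists_length_eq finite_states finite_syms) auto
  ultimately have "finite (trans (verifier M))"
    by (rule finite_subset)
  then show ?thesis
    by (auto simp: wf_tm_def verifier_def)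
qed

lemma syms_basic [simp]: "Blank \<in> syms M" "Zero \<in> syms M" "One \<in> syms M" "Sep \<in> syms M"
    "Aux 0 \<in> syms M" "Aux (Suc 0) \<in> syms M" "Aux 2 \<in> syms M"
  by (auto simp: syms_def)

lemma csyms_syms: "set csyms \<subseteq> syms M"
  by (auto simp: csyms_def)

lemma move_UNIV: "(d :: move) \<in> {Left, Stay, Right}"
  by (cases d) auto

lemma mark_syms [simp]: "mark s \<in> syms M" by (cases s) auto
lemma unmark_syms [simp]: "unmark s \<in> syms M" by (cases s) auto

lemma states_basic [simp]: "Start \<in> states M" "Rd \<in> states M" "RW \<in> states M" "Cp \<in> states M" "RM \<in> states M"
    "QL \<in> states M" "QS \<in> states M" "QC \<in> states M" "QB b \<in> states M" "Acc \<in> states M" "Rd2 Zero \<in> states M"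
    "Rd2 One \<in> states M" "Ld n \<in> states M \<longleftrightarrow> n \<le> 6" "G u bd \<in> states M" "Run (start M) \<in> states M"
    "Run (yes M) \<in> states M" "Run (no M) \<in> states M" "Run (query M) \<in> states M"
  by (cases b; auto simp: states_def)+

text \<open>Together with \<open>work_closed\<close> this shows that the bounds in the transition
  set of \<open>verifier\<close> cut off no rule: one that applies within the alphabet stays within
  it and hence is a transition.\<close>

lemma load_closed:
  assumes "load q i w c h q' aw ac ah" "q \<in> states M" "i \<in> {Zero, One}" "{w, c, h} \<subseteq> syms M"
  shows "q' \<in> states M \<and> {fst aw, fst ac, fst ah} \<subseteq> syms M"
  using assms
proof cases
  case (6 n)
  have "length csyms = 6" by (simp add: csyms_def)
  with \<open>n < 6\<close> have "csyms ! n \<in> set csyms" by simp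
  with csyms_syms have "csyms ! n \<in> syms M" by blast
  moreover have "fst ac = csyms ! n" using 6 by simp
  moreover have "q' \<in> states M \<and> {fst aw, fst ah} \<subseteq> syms M"
    using assms(4) 6 by simp
  ultimately show ?thesis by simp
qed auto

lemma set_stay_upd:
  "set rs \<subseteq> S \<Longrightarrow> s \<in> S \<Longrightarrow> fst ` set ((map stay rs)[i := (s, d)]) \<subseteq> S"
  using set_update_subset_insert[of "map stay rs" i "(s, d)"] by fastforce

lemma work_closed:
  assumes "work M q w c h rs q' aw ac ah as" "q \<in> states M" "{w, c, h} \<subseteq> syms M" "set rs \<subseteq> syms M"
    "length rs = tapes M" "wf_oracle_tm M"
  shows "q' \<in> states M \<and> {fst aw, fst ac, fst ah} \<subseteq> syms M \<and> fst ` set as \<subseteq> syms M \<and> length as = tapes M"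
  using assms
proof cases
  case (Run_step p p')
  have "p' \<in> (\<Union>(q, r, q', a) \<in> trans M. {q'})" using Run_step by blast
  then have 1: "Run p' \<in> states M" unfolding states_def by blast
  have 2: "fst ` set as \<subseteq> syms M" using Run_step unfolding syms_def by blast
  show ?thesis using Run_step 1 2 assms by (auto simp: wf_oracle_tm_def wf_tm_def)
next
  case RM1
  then have "rs ! 0 \<in> syms M" using assms by (force simp: wf_oracle_tm_def)
  then show ?thesis using RM1 set_stay_upd[OF assms(4), of "rs!0"] assms by auto
next
  case QL1
  then have "rs ! 1 \<in> syms M" using assms by (force simp: wf_oracle_tm_def)
  then show ?thesis using QL1 set_stay_upd[OF assms(4), of "rs!1"] assms by auto
next
  case QB1
  then have "rs ! 1 \<in> syms M" using assms by (force simp: wf_oracle_tm_def)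
  then show ?thesis using QB1 set_stay_upd[OF assms(4), of "rs!1"] assms by auto
next
  case QC1
  then show ?thesis using set_stay_upd[OF assms(4), of c] assms by auto
next
  case (G_bit s)
  then have "s \<in> syms M" by auto
  then show ?thesis using G_bit set_stay_upd[OF assms(4), of s] assms(3) by (auto simp: assms)
next
  case G_sep
  then show ?thesis using set_stay_upd[OF assms(4), of Sep] assms by auto
next
  case Cp1
  then show ?thesis using set_stay_upd[OF assms(4), of w] assms by auto
next
  case Cp2
  then show ?thesis using set_stay_upd[OF assms(4), of Sep] assms by auto
qed (use assms in auto)

section \<open>Halting, with the input as a clock\<close>

lemma step_verifier_input:
  assumes "step (verifier M) (q, (f, p) # ts) c"
  shows "f p \<in> {Zero, One} \<and> (\<exists>q' ts'. c = (q', (f, Suc p) # ts'))"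
proof -
  obtain q' ts' where c: "c = (q', ts')" by (cases c)
  from assms obtain a where a: "rule M q (f p # map read ts) q' a" "ts' = map2 act a ((f, p) # ts)"
    unfolding c step.simps by (auto simp: verifier_def)
  from a(1) show ?thesis
  proof cases
    case load
    then show ?thesis by (simp add: c a(2))
  next
    case work
    then show ?thesis by (simp add: c a(2))
  qed
qed

text \<open>The input head position equals the number of steps, and a step needs a bit under that
  head; behind the word there are only blanks.\<close>

lemma steps_verifier_input:
  "(step (verifier M) ^^ n) (init (verifier M) w) c \<Longrightarrow> n \<le> length w \<and> (\<exists>q ts. c = (q, (cont w, n) # ts))"
proof (induction n arbitrary: c)
  case 0
  then show ?case by (auto simp: init_def tape_of_cont)
next
  case (Suc n)
  from Suc.prems obtain d where d: "(step (verifier M) ^^ n) (init (verifier M) w) d" "step (verifier M) d c"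
    by auto
  from Suc.IH[OF d(1)] obtain q ts where "n \<le> length w" "d = (q, (cont w, n) # ts)" by blast
  with step_verifier_input[of M q "cont w" n ts c] d(2) show ?case
    by (cases "n < length w") (auto simp: cont_def[of w n])
qed

lemma verifier_halts: "halts_within (verifier M) w (length w)"
  unfolding halts_within_def using steps_verifier_input by blast

section \<open>Working steps with the input tape abstracted away\<close>

type_synonym wconfig = "vstate \<times> tape \<times> tape \<times> tape \<times> tape list"

inductive tick :: "(nat, 'm) oracle_tm_scheme \<Rightarrow> wconfig \<Rightarrow> wconfig \<Rightarrow> bool" for M where
  "work M q (read W) (read C) (read H) (map read ts) q' aw ac ah as \<Longrightarrow>
    tick M (q, W, C, H, ts) (q', act aw W, act ac C, act ah H, map2 act as ts)"

definition in_alphabet :: "(nat, 'm) oracle_tm_scheme \<Rightarrow> wconfig \<Rightarrow> bool" where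
  "in_alphabet M = (\<lambda>(q, W, C, H, ts). q \<in> states M \<and> length ts = tapes M \<and>
    (\<forall>t \<in> {W, C, H} \<union> set ts. range (fst t) \<subseteq> syms M))"

definition with_input :: "nat \<Rightarrow> (nat \<Rightarrow> sym) \<Rightarrow> wconfig \<Rightarrow> vstate config" where
  "with_input p f = (\<lambda>(q, W, C, H, ts). (q, (f, p) # W # C # H # ts))"

lemma read_syms: "range (fst t) \<subseteq> S \<Longrightarrow> read t \<in> S"
  by (cases t) auto

lemma act_syms: "range (fst t) \<subseteq> S \<Longrightarrow> fst a \<in> S \<Longrightarrow> range (fst (act a t)) \<subseteq> S"
  by (cases t; cases a) auto

lemma map2_act_syms:
  assumes "\<forall>t \<in> set ts. range (fst t) \<subseteq> S" "fst ` set as \<subseteq> S" "t \<in> set (map2 act as ts)"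
  shows "range (fst t) \<subseteq> S"
proof -
  from assms(3) obtain p where p: "p \<in> set (zip as ts)" "t = act (fst p) (snd p)"
    by (auto simp: case_prod_beta simp del: act.simps)
  from p(1) have "fst p \<in> set as" "snd p \<in> set ts"
    by (metis prod.collapse set_zip_leftD) (metis p(1) prod.collapse set_zip_rightD)
  with assms(1,2) have "range (fst (snd p)) \<subseteq> S" "fst (fst p) \<in> S" by auto
  then show ?thesis unfolding p(2) by (rule act_syms)
qed

lemma in_alphabet_reads:
  assumes "in_alphabet M (q, W, C, H, ts)"
  shows "{read W, read C, read H} \<subseteq> syms M" "set (map read ts) \<subseteq> syms M" "length (map read ts) = tapes M"
    "q \<in> states M"
proof -
  show "{read W, read C, read H} \<subseteq> syms M"
    using assms read_syms[of W] read_syms[of C] read_syms[of H] unfolding in_alphabet_def by simp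
  have "read t \<in> syms M" if "t \<in> set ts" for t
    using assms that unfolding in_alphabet_def by (intro read_syms) simp
  then show "set (map read ts) \<subseteq> syms M" by (simp add: image_subset_iff)
qed (use assms in \<open>auto simp: in_alphabet_def\<close>)

lemma tick_in_alphabet:
  assumes "tick M a b" "in_alphabet M a" "wf_oracle_tm M"
  shows "in_alphabet M b"
  using assms(1)
proof cases
  case (1 q W C H ts q' aw ac ah as)
  note r = in_alphabet_reads[OF assms(2)[unfolded 1(1)]]
  have "q' \<in> states M \<and> {fst aw, fst ac, fst ah} \<subseteq> syms M \<and> fst ` set as \<subseteq> syms M \<and> length as = tapes M"
    using 1(3) r assms(3) by (intro work_closed)
  moreover from this have "\<forall>t \<in> set (map2 act as ts). range (fst t) \<subseteq> syms M"
    using map2_act_syms[of ts "syms M" as] assms(2) by (simp add: 1 in_alphabet_def del: set_map)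
  moreover have "length ts = tapes M" "range (fst W) \<subseteq> syms M" "range (fst C) \<subseteq> syms M" "range (fst H) \<subseteq> syms M"
    using assms(2) by (simp_all add: 1 in_alphabet_def)
  ultimately show ?thesis
    by (simp add: 1 in_alphabet_def act_syms del: set_map)
qed

lemma set_subset_moves: "set a \<subseteq> S \<times> {Left, Stay, Right} \<longleftrightarrow> fst ` set a \<subseteq> S"
  using move_UNIV by fastforce

lemma tick_step:
  assumes "tick M a b" "in_alphabet M a" "wf_oracle_tm M" "f p \<in> {Zero, One}"
  shows "step (verifier M) (with_input p f a) (with_input (Suc p) f b)"
  using assms(1)
proof cases
  case (1 q W C H ts q' aw ac ah as)
  note r = in_alphabet_reads[OF assms(2)[unfolded 1(1)]]
  have c: "q' \<in> states M \<and> {fst aw, fst ac, fst ah} \<subseteq> syms M \<and> fst ` set as \<subseteq> syms M \<and> length as = tapes M"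
    using 1(3) r assms(3) by (intro work_closed)
  have "rule M q (f p # read W # read C # read H # map read ts) q' ((f p, Right) # aw # ac # ah # as)"
    using 1(3) assms(4) by (rule rule.work)
  then have "(q, f p # read W # read C # read H # map read ts, q', (f p, Right) # aw # ac # ah # as)
      \<in> trans (verifier M)"
    using c r assms(4) by (auto simp: verifier_def set_subset_moves)
  then show ?thesis
    unfolding 1 with_input_def step.simps prod.case by (intro exI conjI) (auto)
qed

lemma ticks_in_alphabet: "(tick M ^^ n) a b \<Longrightarrow> in_alphabet M a \<Longrightarrow> wf_oracle_tm M \<Longrightarrow> in_alphabet M b"
  by (induction n arbitrary: b) (auto dest: tick_in_alphabet)

lemma ticks_steps:
  "(tick M ^^ n) a b \<Longrightarrow> in_alphabet M a \<Longrightarrow> wf_oracle_tm M \<Longrightarrow> (\<And>i. i < n \<Longrightarrow> f (p + i) \<in> {Zero, One}) \<Longrightarrow>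
    (step (verifier M) ^^ n) (with_input p f a) (with_input (p + n) f b)"
proof (induction n arbitrary: b)
  case (Suc n)
  then obtain d where d: "(tick M ^^ n) a d" "tick M d b" by auto
  have "(step (verifier M) ^^ n) (with_input p f a) (with_input (p + n) f d)"
    using Suc d by simp
  moreover have "step (verifier M) (with_input (p + n) f d) (with_input (Suc (p + n)) f b)"
    using d Suc.prems by (intro tick_step) (auto dest: ticks_in_alphabet)
  ultimately show ?case by auto
qed auto

definition loading :: "vstate \<Rightarrow> bool" where
  "loading q \<longleftrightarrow> q \<in> {Start, Rd} \<union> range Rd2 \<union> range Ld"

lemma load_loading: "load q i w c h q' aw ac ah \<Longrightarrow> loading q"
  by (cases rule: load.cases) (auto simp: loading_def)

lemma work_not_loading: "work M q w c h rs q' aw ac ah as \<Longrightarrow> \<not> loading q \<and> \<not> loading q' \<and> q \<noteq> Acc"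
  by (cases rule: work.cases) (auto simp: loading_def)

text \<open>Loading never resumes once it is over, so all later steps are ticks. Soundness can thus
  be argued on \<open>tick\<close> alone, without regard to what remains of the input.\<close>

lemma step_tick:
  assumes "step (verifier M) (with_input p f a) c" "\<not> loading (fst a)"
  shows "\<exists>b. c = with_input (Suc p) f b \<and> tick M a b \<and> \<not> loading (fst b)"
proof -
  obtain q W C H ts where a: "a = (q, W, C, H, ts)" by (cases a)
  obtain q' ts' where c: "c = (q', ts')" by (cases c)
  from assms(1) obtain r act' where
    *: "rule M q (f p # read W # read C # read H # map read ts) q' act'"
      "ts' = map2 act act' ((f, p) # W # C # H # ts)"
    by (auto simp: a c with_input_def step.simps verifier_def)
  from *(1) show ?thesis
  proof cases
    case (load aw ac ah)
    then show ?thesis using assms(2) load_loading by (auto simp: a)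
  next
    case (work aw ac ah as)
    then have "tick M a (q', act aw W, act ac C, act ah H, map2 act as ts)"
      unfolding a by (intro tick.intros)
    moreover have "c = with_input (Suc p) f (q', act aw W, act ac C, act ah H, map2 act as ts)"
      unfolding c *(2) work by (simp add: with_input_def)
    ultimately show ?thesis using work_not_loading[OF work(2)] 
      by (intro exI[of _ "(q', act aw W, act ac C, act ah H, map2 act as ts)"]) simp
  qed
qed

section \<open>Loading the input\<close>

lemma load_functional:
  assumes "load q i w c h q1 aw1 ac1 ah1" "load q i w c h q2 aw2 ac2 ah2"
  shows "q1 = q2 \<and> aw1 = aw2 \<and> ac1 = ac2 \<and> ah1 = ah2"
  using assms by (elim load.cases) auto

text \<open>In a loading state no \<open>work\<close> rule applies and \<open>load\<close> is
  functional, so the transition found is the only one.\<close>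

lemma load_det_step:
  assumes l': "load q i (read W) (read C) (read H) q' aw ac ah" and ok: "in_alphabet M (q, W, C, H, ts)"
    and f: "f p = i" and i': "i \<in> {Zero, One}"
  shows "det_step (verifier M) (with_input p f (q, W, C, H, ts)) (with_input (Suc p) f (q', act aw W, act ac C, act ah H, ts))"
proof -
  note l = l'[folded f] and i = i'[folded f]
  let ?r = "f p # read W # read C # read H # map read ts"
  let ?a = "(f p, Right) # aw # ac # ah # map stay (map read ts)"
  note r = in_alphabet_reads[OF ok]
  have c: "q' \<in> states M \<and> {fst aw, fst ac, fst ah} \<subseteq> syms M"
    using l r i by (intro load_closed)
  have "rule M q ?r q' ?a"
    using l i by (rule rule.load)
  then have 1: "(q, ?r, q', ?a) \<in> trans (verifier M)"
    using c r i by (auto simp: verifier_def set_subset_moves)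
  have 2: "q2 = q' \<and> a2 = ?a" if "rule M q ?r q2 a2" for q2 a2
    using that
  proof cases
    case (load aw2 ac2 ah2)
    with load_functional[OF load(2) l] show ?thesis by simp
  next
    case (work aw ac ah as)
    then show ?thesis using work_not_loading load_loading[OF l] by blast
  qed
  have 3: "map2 act ?a ((f, p) # W # C # H # ts) = (f, Suc p) # act aw W # act ac C # act ah H # ts"
    using map2_act_stay[of ts] by simp
  have "step (verifier M) (with_input p f (q, W, C, H, ts)) (q2, ts2) \<longleftrightarrow>
      (q2, ts2) = with_input (Suc p) f (q', act aw W, act ac C, act ah H, ts)" for q2 ts2
  proof
    assume "step (verifier M) (with_input p f (q, W, C, H, ts)) (q2, ts2)"
    then obtain a2 where a2: "rule M q ?r q2 a2" "ts2 = map2 act a2 ((f, p) # W # C # H # ts)"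
      by (auto simp: with_input_def step.simps verifier_def)
    with 2[OF a2(1)] 3 show "(q2, ts2) = with_input (Suc p) f (q', act aw W, act ac C, act ah H, ts)"
      by (simp add: with_input_def)
  next
    assume "(q2, ts2) = with_input (Suc p) f (q', act aw W, act ac C, act ah H, ts)"
    with 1 3 show "step (verifier M) (with_input p f (q, W, C, H, ts)) (q2, ts2)"
      unfolding with_input_def step.simps prod.case by (intro exI[of _ ?a]) simp
  qed
  then show ?thesis unfolding det_step_def by (metis surj_pair)
qed

lemma cont_syms: "set w \<subseteq> syms M \<Longrightarrow> range (cont w) \<subseteq> syms M"
  by (auto simp: cont_def)

lemma bits_simps [simp]: "bits [] = []" "bits (b # x) = (if b then One else Zero) # bits x"
    "bits (x @ y) = bits x @ bits y" "length (bits x) = length x"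
  by (auto simp: bits_def)

lemma set_bits: "set (bits x) \<subseteq> {Zero, One}"
  by (auto simp: bits_def)

lemma set_bits_syms: "set (bits x) \<subseteq> syms M"
  using set_bits[of x] by (auto simp: subset_iff)

abbreviation dbl :: "bool list \<Rightarrow> bool list" where
  "dbl x \<equiv> concat (map (\<lambda>b. [b, b]) x)"

lemma cont_append_Suc: "cont (u @ s # s' # v) (Suc (length u)) = s'"
  by (simp add: cont_def nth_append)

text \<open>Here \<open>u\<close> is the input already consumed and \<open>x0\<close> the part of
  \<open>x\<close> already on the work tape; both grow along the induction, by two cells and one
  cell per bit.\<close>

lemma load_word:
  assumes "in_alphabet M (Rd, (cont (Sep # bits x0), Suc (length x0)), C, H, ts)"
  shows "(det_step (verifier M))\<^sup>*\<^sup>*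
    (with_input (length u) (cont (u @ bits (dbl x) @ v)) (Rd, (cont (Sep # bits x0), Suc (length x0)), C, H, ts))
    (with_input (length u + 2 * length x) (cont (u @ bits (dbl x) @ v))
      (Rd, (cont (Sep # bits (x0 @ x)), Suc (length x0 + length x)), C, H, ts))"
  using assms
proof (induction x arbitrary: u x0)
  case (Cons b x)
  define s where "s = (if b then One else Zero)"
  let ?f = "cont (u @ bits (dbl (b # x)) @ v)"
  have s: "s \<in> {Zero, One}" by (simp add: s_def)
  have f: "?f = cont (u @ s # s # bits (dbl x) @ v)" by (simp add: s_def)
  let ?W = "(cont (Sep # bits x0), Suc (length x0))"
  let ?W' = "(cont (Sep # bits (x0 @ [b])), Suc (length (x0 @ [b])))"
  have W': "act (s, Right) ?W = ?W'"
    using cont_snoc[of "Sep # bits x0" s] by (simp add: s_def)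
  have ok: "in_alphabet M (q, ?W, C, H, ts) \<and> in_alphabet M (q, ?W', C, H, ts)" if "q \<in> states M" for q
    using Cons.prems that set_bits_syms[of x0 M] cont_syms[of "Sep # bits (x0 @ [b])" M] by (auto simp: in_alphabet_def)
  have "det_step (verifier M) (with_input (length u) ?f (Rd, ?W, C, H, ts)) (with_input (Suc (length u)) ?f (Rd2 s, ?W, C, H, ts))"
  proof -
    have "load Rd s (read ?W) (read C) (read H) (Rd2 s) (stay (read ?W)) (stay (read C)) (stay (read H))"
      by (rule load.intros)
    from load_det_step[OF this ok[of Rd, THEN conjunct1] _ s, of ?f "length u"] show ?thesis
      unfolding act_stay f cont_append by simp
  qed
  moreover have "det_step (verifier M) (with_input (Suc (length u)) ?f (Rd2 s, ?W, C, H, ts))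
      (with_input (Suc (Suc (length u))) ?f (Rd, ?W', C, H, ts))"
  proof -
    have "load (Rd2 s) s (read ?W) (read C) (read H) Rd (s, Right) (stay (read C)) (stay (read H))"
      by (rule load.intros)
    from load_det_step[OF this ok[of "Rd2 s", THEN conjunct1] _ s, of ?f "Suc (length u)"] show ?thesis
      using s unfolding act_stay W' f cont_append_Suc by auto
  qed
  moreover have "(det_step (verifier M))\<^sup>*\<^sup>* (with_input (Suc (Suc (length u))) ?f (Rd, ?W', C, H, ts))
    (with_input (length u + 2 * length (b # x)) ?f
      (Rd, (cont (Sep # bits (x0 @ b # x)), Suc (length x0 + length (b # x))), C, H, ts))"
    using Cons.IH[OF ok[of Rd, THEN conjunct2], of "u @ [s, s]"] by (simp add: s_def)
  ultimately show ?case by (simp add: converse_rtranclp_into_rtranclp)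
qed simp

lemma load_unary:
  assumes "in_alphabet M (Ld i, W, C, H, ts)" "i + j \<le> 6"
  shows "(det_step (verifier M))\<^sup>*\<^sup>* (with_input (length u) (cont (u @ replicate j One @ v)) (Ld i, W, C, H, ts))
    (with_input (length u + j) (cont (u @ replicate j One @ v)) (Ld (i + j), W, C, H, ts))"
  using assms
proof (induction j arbitrary: u i)
  case (Suc j)
  let ?f = "cont (u @ replicate (Suc j) One @ v)"
  have l: "load (Ld i) One (read W) (read C) (read H) (Ld (Suc i)) (stay (read W)) (stay (read C)) (stay (read H))"
    using Suc.prems by (intro load.intros) simp
  have "det_step (verifier M) (with_input (length u) ?f (Ld i, W, C, H, ts)) (with_input (Suc (length u)) ?f (Ld (Suc i), W, C, H, ts))"
    using load_det_step[OF l Suc.prems(1), of ?f "length u"] unfolding act_stay by simp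
  moreover have "in_alphabet M (Ld (Suc i), W, C, H, ts)" using Suc.prems by (auto simp: in_alphabet_def)
  note Suc.IH[OF this, of "u @ [One]"]
  ultimately show ?case using Suc.prems by (simp add: converse_rtranclp_into_rtranclp)
qed simp

fun ix :: "sym \<Rightarrow> nat" where
  "ix Zero = 0"
| "ix One = 1"
| "ix Sep = 2"
| "ix (Aux n) = 3 + n"
| "ix Blank = 0"

text \<open>The unary number \<open>ix s\<close> inverts \<open>csyms\<close>. The code is
  prefix-free, and the decoder only has to count ones in its state \<open>Ld n\<close>.\<close>

definition code :: "sym \<Rightarrow> bool list" where
  "code s = replicate (ix s) True @ [False]"

lemma bits_replicate [simp]: "bits (replicate n True) = replicate n One"
  by (induction n) auto

lemma code_simps [simp]: "bits (code s) = replicate (ix s) One @ [Zero]" "length (code s) = Suc (ix s)"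
  by (simp_all add: code_def)

lemma ix_csyms: "s \<in> set csyms \<Longrightarrow> ix s < 6 \<and> csyms ! ix s = s"
  by (auto simp: csyms_def)

lemma load_table:
  assumes "in_alphabet M (Ld 0, W, (cont c0, length c0), H, ts)" "set c0 \<subseteq> set csyms" "set c \<subseteq> set csyms"
  shows "(det_step (verifier M))\<^sup>*\<^sup>*
    (with_input (length u) (cont (u @ bits (concat (map code c)) @ v)) (Ld 0, W, (cont c0, length c0), H, ts))
    (with_input (length u + length (concat (map code c))) (cont (u @ bits (concat (map code c)) @ v))
      (Ld 0, W, (cont (c0 @ c), length (c0 @ c)), H, ts))"
  using assms
proof (induction c arbitrary: u c0)
  case (Cons s c)
  let ?f = "cont (u @ bits (concat (map code (s # c))) @ v)"
  let ?C = "(cont c0, length c0)"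
  let ?u = "u @ replicate (ix s) One"
  have f: "?f = cont (u @ replicate (ix s) One @ Zero # bits (concat (map code c)) @ v)"
    by simp
  have f': "?f = cont (?u @ Zero # bits (concat (map code c)) @ v)"
    by simp
  have s: "ix s < 6" "csyms ! ix s = s" "s \<in> syms M" using Cons.prems ix_csyms csyms_syms[of M] by auto
  have "(det_step (verifier M))\<^sup>*\<^sup>* (with_input (length u) ?f (Ld 0, W, ?C, H, ts)) (with_input (length ?u) ?f (Ld (ix s), W, ?C, H, ts))"
    using load_unary[OF Cons.prems(1), of "ix s" u] s unfolding f by simp
  moreover have "det_step (verifier M) (with_input (length ?u) ?f (Ld (ix s), W, ?C, H, ts))
     (with_input (Suc (length ?u)) ?f (Ld 0, W, (cont (c0 @ [s]), length (c0 @ [s])), H, ts))"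
  proof -
    have l: "load (Ld (ix s)) Zero (read W) (read ?C) (read H) (Ld 0) (stay (read W)) (csyms ! ix s, Right) (stay (read H))"
      using s by (intro load.intros)
    have ok: "in_alphabet M (Ld (ix s), W, ?C, H, ts)" using Cons.prems s by (auto simp: in_alphabet_def)
    have "?f (length ?u) = Zero" unfolding f' cont_append by simp
    note load_det_step[OF l ok, of ?f "length ?u", OF this]
    then show ?thesis unfolding act_stay s act.simps cont_snoc by simp
  qed
  moreover have "in_alphabet M (Ld 0, W, (cont (c0 @ [s]), length (c0 @ [s])), H, ts)"
    using Cons.prems cont_syms[of "c0 @ [s]" M] csyms_syms[of M] by (auto simp: in_alphabet_def)
  note Cons.IH[OF this, of "?u @ [Zero]"]
  then have "(det_step (verifier M))\<^sup>*\<^sup>*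
      (with_input (Suc (length ?u)) ?f (Ld 0, W, (cont (c0 @ [s]), length (c0 @ [s])), H, ts))
      (with_input (length u + length (concat (map code (s # c)))) ?f
        (Ld 0, W, (cont (c0 @ s # c), length (c0 @ s # c)), H, ts))"
    using Cons.prems by (simp add: f' add.assoc)
  ultimately show ?case
    by (rule rtranclp_trans[OF _ converse_rtranclp_into_rtranclp])
qed simp

text \<open>The encoded table, then six ones and a zero as end marker, then \<open>m\<close> ones
  that are never decoded and only supply steps.\<close>

definition advice :: "sym list \<Rightarrow> nat \<Rightarrow> bool list" where
  "advice c m = concat (map code c) @ replicate 6 True @ False # replicate m True"

definition loaded :: "(nat, 'm) oracle_tm_scheme \<Rightarrow> bool list \<Rightarrow> sym list \<Rightarrow> wconfig" where
  "loaded M x c = (RW, (cont (Sep # bits x), Suc (length x)), (cont c, length c), (cont [Sep], 0),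
     replicate (tapes M) (cont [], 0))"

lemma loaded_in_alphabet: "set c \<subseteq> set csyms \<Longrightarrow> in_alphabet M (loaded M x c)"
  using set_bits_syms[of x M] cont_syms[of "Sep # bits x" M] cont_syms[of c M] cont_syms[of "[Sep]" M]
    cont_syms[of "[]" M] csyms_syms[of M]
  by (auto simp: in_alphabet_def loaded_def)

text \<open>All steps up to \<open>loaded\<close> are forced, so acceptance can be judged there.
  What then lies ahead of the input head are the \<open>m\<close> padding ones, the time available
  for guessing and simulating.\<close>

lemma accepts_verifier:
  fixes x :: "bool list" and m :: nat
  assumes c: "set c \<subseteq> set csyms"
  defines "w \<equiv> bits (pair x (advice c m))"
  shows "\<exists>p. (\<forall>i < m. cont w (p + i) = One) \<and>
    (accepts (verifier M) w \<longleftrightarrow> acc_from (verifier M) (with_input p (cont w) (loaded M x c)))"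
proof -
  let ?M = "verifier M" and ?f = "cont w" and ?ts = "replicate (tapes M) (cont [], 0)"
  let ?B = "(cont [], 0)" and ?S = "(cont [Sep], 0)" and ?S1 = "(cont [Sep], Suc 0)"
  let ?W = "(cont (Sep # bits x), Suc (length x))" and ?C = "(cont c, length c)"
  let ?v = "bits (concat (map code c))"
  let ?p2 = "length (bits (dbl x) @ [Zero, One])"
  let ?p3 = "length (bits (dbl x) @ [Zero, One] @ ?v)"
  have w: "w = bits (dbl x) @ [Zero, One] @ ?v @ replicate 6 One @ Zero # replicate m One"
    by (simp add: w_def pair_def advice_def numeral_eq_Suc)
  have rs: "range (cont []) \<subseteq> syms M" "range (cont [Sep]) \<subseteq> syms M" "range (cont c) \<subseteq> syms M"
      "range (cont (Sep # bits x)) \<subseteq> syms M"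
    using c csyms_syms[of M] set_bits_syms[of x M] by (auto intro!: cont_syms)
  have ok: "in_alphabet M (q, W, C, H, ?ts)" if "q \<in> states M" "W \<in> {?B, ?S1, ?W}" "C \<in> {?B, ?C}" "H \<in> {?B, ?S}"
    for q W C H
    using that by (elim insertE emptyE; simp add: in_alphabet_def rs)
  have acts: "act (Sep, Right) ?B = ?S1" "act (stay Sep) ?B = ?S"
    using cont_snoc[of "[]" Sep] by auto
  have "tapes ?M - 1 = Suc (Suc (Suc (tapes M)))"
    by (simp add: verifier_def)
  then have "init ?M w = with_input 0 ?f (Start, ?B, ?B, ?B, ?ts)"
    by (simp add: init_def with_input_def tape_of_cont) (simp add: verifier_def)
  then have "accepts ?M w \<longleftrightarrow> acc_from ?M (with_input 0 ?f (Start, ?B, ?B, ?B, ?ts))"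
    by (simp add: accepts_acc_from)
  \<comment> \<open>Both configurations have the same unique successor: \<open>Start\<close> acts
    like \<open>Rd\<close> on tapes that already carry the end markers. So \<open>load_word\<close>
    can begin at input cell 0.\<close>
  also have "\<dots> \<longleftrightarrow> acc_from ?M (with_input 0 ?f (Rd, ?S1, ?B, ?S, ?ts))"
  proof -
    let ?s = "?f 0"
    have s: "?s \<in> {Zero, One}" by (cases x) (auto simp: w)
    then have s': "Rd2 ?s \<in> states M" by auto
    have "load Start ?s (read ?B) (read ?B) (read ?B) (Rd2 ?s) (Sep, Right) (stay (read ?B)) (stay Sep)"
      by (rule load.intros)
    from load_det_step[OF this ok _ s, of ?f 0] s'
    have 1: "det_step ?M (with_input 0 ?f (Start, ?B, ?B, ?B, ?ts)) (with_input (Suc 0) ?f (Rd2 ?s, ?S1, ?B, ?S, ?ts))"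
      unfolding acts act_stay by simp
    have "load Rd ?s (read ?S1) (read ?B) (read ?S) (Rd2 ?s) (stay (read ?S1)) (stay (read ?B)) (stay (read ?S))"
      by (rule load.intros)
    from load_det_step[OF this ok _ s, of ?f 0] s'
    have 2: "det_step ?M (with_input 0 ?f (Rd, ?S1, ?B, ?S, ?ts)) (with_input (Suc 0) ?f (Rd2 ?s, ?S1, ?B, ?S, ?ts))"
      unfolding act_stay by simp
    show ?thesis using acc_from_det_step[OF 1] acc_from_det_step[OF 2] by simp
  qed
  also have "\<dots> \<longleftrightarrow> acc_from ?M (with_input (2 * length x) ?f (Rd, ?W, ?B, ?S, ?ts))"
    using load_word[of M "[]" ?B ?S ?ts "[]" x, OF ok] unfolding w
    by (intro acc_from_det_steps) simp
  also have "\<dots> \<longleftrightarrow> acc_from ?M (with_input (Suc (2 * length x)) ?f (Rd2 Zero, ?W, ?B, ?S, ?ts))"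
  proof -
    have l: "length (bits (dbl x)) = 2 * length x" by (induction x) auto
    have s: "?f (2 * length x) = Zero" unfolding w l[symmetric] append.simps by (rule cont_append)
    have "load Rd Zero (read ?W) (read ?B) (read ?S) (Rd2 Zero) (stay (read ?W)) (stay (read ?B)) (stay (read ?S))"
      by (rule load.intros)
    from load_det_step[OF this ok, of ?f "2 * length x", OF _ _ _ _ s] show ?thesis
      unfolding act_stay by (intro acc_from_det_step) simp
  qed
  also have "\<dots> \<longleftrightarrow> acc_from ?M (with_input ?p2 ?f (Ld 0, ?W, ?B, ?S, ?ts))"
  proof -
    have l: "length (bits (dbl x)) = 2 * length x" by (induction x) auto
    have s: "?f (Suc (2 * length x)) = One" unfolding w l[symmetric] append.simps by (rule cont_append_Suc)
    have "load (Rd2 Zero) One (read ?W) (read ?B) (read ?S) (Ld 0) (stay (read ?W)) (stay (read ?B)) (stay (read ?S))"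
      by (rule load.intros)
    from load_det_step[OF this ok, of ?f "Suc (2 * length x)", OF _ _ _ _ s] l show ?thesis
      unfolding act_stay by (intro acc_from_det_step) simp
  qed
  also have "\<dots> \<longleftrightarrow> acc_from ?M (with_input ?p3 ?f (Ld 0, ?W, ?C, ?S, ?ts))"
    using load_table[of M ?W "[]" ?S ?ts c "bits (dbl x) @ [Zero, One]", OF ok] c unfolding w
    by (intro acc_from_det_steps) simp
  also have "\<dots> \<longleftrightarrow> acc_from ?M (with_input (?p3 + 6) ?f (Ld 6, ?W, ?C, ?S, ?ts))"
    using load_unary[of M 0 ?W ?C ?S ?ts 6 "bits (dbl x) @ [Zero, One] @ ?v", OF ok] unfolding w
    by (intro acc_from_det_steps) simp
  also have "\<dots> \<longleftrightarrow> acc_from ?M (with_input (?p3 + 7) ?f (RW, ?W, ?C, ?S, ?ts))"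
  proof -
    have s: "?f (?p3 + 6) = Zero"
    proof -
      have 1: "w = (bits (dbl x) @ [Zero, One] @ ?v @ replicate 6 One) @ Zero # replicate m One"
        by (simp add: w)
      have 2: "?p3 + 6 = length (bits (dbl x) @ [Zero, One] @ ?v @ replicate 6 One)" by simp
      show ?thesis unfolding 1 2 by (rule cont_append)
    qed
    have "load (Ld 6) Zero (read ?W) (read ?C) (read ?S) RW (stay (read ?W)) (stay (read ?C)) (stay (read ?S))"
      by (rule load.intros)
    from load_det_step[OF this ok, of ?f "?p3 + 6", OF _ _ _ _ s] show ?thesis
      unfolding act_stay by (intro acc_from_det_step) (simp add: numeral_eq_Suc)
  qed
  finally have "accepts ?M w \<longleftrightarrow> acc_from ?M (with_input (?p3 + 7) ?f (loaded M x c))"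
    by (simp add: loaded_def)
  moreover have "?f (?p3 + 7 + i) = One" if "i < m" for i
  proof -
    have w': "w = (bits (dbl x) @ [Zero, One] @ ?v @ replicate 6 One @ [Zero]) @ replicate m One"
      by (simp add: w)
    have l: "?p3 + 7 = length (bits (dbl x) @ [Zero, One] @ ?v @ replicate 6 One @ [Zero])" by simp
    show ?thesis unfolding w' l using that unfolding cont_def nth_append by simp
  qed
  ultimately show ?thesis by blast
qed

section \<open>Oracle computations\<close>

text \<open>Unlike \<open>oracle_run\<close> this records neither time nor queries; soundness only
  asks which configurations occur in a true oracle computation.\<close>

definition ostep :: "('q, 'm) oracle_tm_scheme \<Rightarrow> sym list set \<Rightarrow> 'q config \<Rightarrow> 'q config \<Rightarrow> bool" where
  "ostep M Q c c' \<longleftrightarrow>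
    (if fst c = query M then c' = (if word_on (snd c ! 1) \<in> Q then yes M else no M, snd c) else step M c c')"

lemma oracle_run_ostep: "oracle_run M Q c n qs c' \<Longrightarrow> (ostep M Q)\<^sup>*\<^sup>* c c'"
proof (induction rule: oracle_run.induct)
  case (compute c c' n qs c'')
  then have "ostep M Q c c'" by (simp add: ostep_def)
  with compute show ?case by (meson converse_rtranclp_into_rtranclp)
next
  case (ask w ts n qs c'')
  then have "ostep M Q (query M, ts) (if w \<in> Q then yes M else no M, ts)" by (simp add: ostep_def)
  with ask show ?case by (meson converse_rtranclp_into_rtranclp)
qed simp

lemma ostep_fun: "deterministic M \<Longrightarrow> ostep M Q c a \<Longrightarrow> ostep M Q c b \<Longrightarrow> a = b"
  unfolding ostep_def deterministic_def
  by (cases c; cases a; cases b) (auto simp: step.simps split: if_splits, blast+)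

lemma halted_no_ostep: "oracle_halted M c \<Longrightarrow> \<not> ostep M Q c d"
  unfolding oracle_halted_def ostep_def by meson

text \<open>By determinism \<open>a\<close> remains reachable from every configuration on the way to
  \<open>b\<close>, hence from \<open>b\<close> itself, which has no successor.\<close>

lemma osteps_halted_unique:
  assumes "deterministic M" "(ostep M Q)\<^sup>*\<^sup>* c a" "oracle_halted M a" "(ostep M Q)\<^sup>*\<^sup>* c b" "oracle_halted M b"
  shows "a = b"
proof -
  from assms(4) have "(ostep M Q)\<^sup>*\<^sup>* b a"
  proof (induction rule: rtranclp_induct)
    case base
    then show ?case using assms(2) .
  next
    case (step y z)
    from step.IH show ?case
    proof (cases rule: converse_rtranclpE)
      case base
      then show ?thesis using step.hyps(2) halted_no_ostep[OF assms(3)] by blast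
    next
      case (step y')
      then show ?thesis using ostep_fun[OF assms(1)] \<open>ostep M Q y z\<close> by blast
    qed
  qed
  then show ?thesis
    by (cases rule: converse_rtranclpE) (use halted_no_ostep[OF assms(5)] in auto)
qed

section \<open>The table of answered queries\<close>

text \<open>\<open>Aux 2\<close> only opens entries, \<open>Aux 0\<close> and \<open>Aux 1\<close>
  only close them, and an encoded instance contains no auxiliary symbol. Both ends of an entry are
  therefore visible locally to a wandering head.\<close>

definition entry :: "inst \<times> bool \<Rightarrow> sym list" where
  "entry = (\<lambda>(y, b). Aux 2 # enc_inst y @ [Aux (of_bool b)])"

definition table :: "(inst \<times> bool) list \<Rightarrow> sym list" where
  "table es = concat (map entry es)"

lemma set_enc_inst: "set (enc_inst y) \<subseteq> {Zero, One, Sep}"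
  using set_bits by (force simp: enc_inst_def split: prod.splits)

lemma set_table: "set (table es) \<subseteq> set csyms"
  using set_enc_inst by (force simp: table_def entry_def csyms_def split: prod.splits)

lemma append_Aux_eq:
  assumes "w @ Aux a # v = w' @ Aux b # v'" "set w \<subseteq> {Zero, One, Sep}" "set w' \<subseteq> {Zero, One, Sep}"
  shows "w = w' \<and> a = b \<and> v = v'"
  using assms
proof (induction w arbitrary: w')
  case Nil
  then show ?case by (cases w') auto
next
  case (Cons s w)
  then show ?case by (cases w') auto
qed

lemma append_Aux_eq_append:
  assumes "w @ Aux a # v = u @ Aux 2 # v'" "set w \<subseteq> {Zero, One, Sep}" "a \<noteq> 2"
  shows "\<exists>u'. v = u' @ Aux 2 # v'"
  using assms
proof (induction w arbitrary: u)
  case Nil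
  then show ?case by (cases u) auto
next
  case (Cons s w)
  then show ?case by (cases u) auto
qed

text \<open>A comparison may start at any \<open>Aux 2\<close> that the head happens to find. As
  this symbol only opens entries and the next auxiliary symbol closes the same entry, a completed
  comparison is one with a whole entry, and the answer read belongs to it.\<close>

lemma table_entry:
  assumes "table es = u @ Aux 2 # w @ Aux (of_bool b) # v" "set w \<subseteq> {Zero, One, Sep}"
  shows "\<exists>y. (y, b) \<in> set es \<and> w = enc_inst y"
  using assms(1)
proof (induction es arbitrary: u)
  case Nil
  then show ?case by (simp add: table_def)
next
  case (Cons e es)
  obtain y b' where e: "e = (y, b')" by (cases e)
  have eq: "Aux 2 # enc_inst y @ Aux (of_bool b') # table es = u @ Aux 2 # w @ Aux (of_bool b) # v"
    using Cons.prems by (simp add: table_def entry_def e)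
  show ?case
  proof (cases u)
    case Nil
    with eq have "enc_inst y @ Aux (of_bool b') # table es = w @ Aux (of_bool b) # v" by simp
    from append_Aux_eq[OF this set_enc_inst assms(2)] show ?thesis by (intro exI[of _ y]) (auto simp: e of_bool_def split: if_splits)
  next
    case (Cons s u')
    with eq have "enc_inst y @ Aux (of_bool b') # table es = u' @ Aux 2 # w @ Aux (of_bool b) # v" by simp
    from append_Aux_eq_append[OF this set_enc_inst] obtain u'' where "table es = u'' @ Aux 2 # w @ Aux (of_bool b) # v"
      by (cases b') auto
    from Cons.IH[OF this] show ?thesis by auto
  qed
qed

section \<open>Soundness of the simulation\<close>

text \<open>Tape \<open>H\<close> during a query, with the symbol at the home position
  \<open>j\<close> of the query head replaced by its marked version. Having two marked symbols keeps
  the left end recognisable when \<open>j = 0\<close>.\<close>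

definition hmark :: "nat \<Rightarrow> nat \<Rightarrow> sym" where
  "hmark j = (cont [Sep])(j := mark (cont [Sep] j))"

text \<open>The simulated configuration belongs to a genuine computation with the true oracle on
  some sequence containing \<open>x\<close>. Length and other components of the sequence stay open,
  as the guess does not restrict them.\<close>

definition reach :: "(nat, 'm) oracle_tm_scheme \<Rightarrow> sym list set \<Rightarrow> bool list \<Rightarrow> nat config \<Rightarrow> bool" where
  "reach M Q x c \<longleftrightarrow> (\<exists>xs. x \<in> set xs \<and> (ostep M Q)\<^sup>*\<^sup>* (init M (enc_seq xs)) c)"

text \<open>While a query is processed, the head of the query tape is at \<open>i\<close>, but the simulated machine has
  it at the marked position \<open>j\<close>.\<close>

definition displaced :: "(nat, 'm) oracle_tm_scheme \<Rightarrow> sym list set \<Rightarrow> bool list \<Rightarrow>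
    (nat \<Rightarrow> sym) \<Rightarrow> nat \<Rightarrow> tape \<Rightarrow> tape list \<Rightarrow> bool" where
  "displaced M Q x f i H ts \<longleftrightarrow> (\<exists>j. reach M Q x (query M, ts[1 := (f, j)]) \<and>
     length ts = tapes M \<and> ts ! 1 = (f, i) \<and> H = (hmark j, i))"

definition guessed :: "(nat, 'm) oracle_tm_scheme \<Rightarrow> sym list \<Rightarrow> nat \<Rightarrow> tape \<Rightarrow> tape list \<Rightarrow> bool" where
  "guessed M v i H ts \<longleftrightarrow> H = (cont [Sep], i) \<and> ts = (cont v, i) # replicate (tapes M - 1) (cont [], 0)"

text \<open>The arguments \<open>i\<close> and \<open>p\<close> are the head positions on
  \<open>W\<close> and \<open>C\<close>; the contents of these tapes are fixed in
  \<open>winv\<close>. Until \<open>x\<close> is used, the head of \<open>W\<close> waits at its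
  first letter, and \<open>bd\<close> says that no component is under way, so \<open>x\<close> is
  copied as a whole component. In \<open>QC\<close>, \<open>w\<close> is the part compared so far:
  it follows an \<open>Aux 2\<close> in the table and fills the first \<open>j\<close> cells of the
  query tape.\<close>

fun inv :: "(nat, 'm) oracle_tm_scheme \<Rightarrow> sym list set \<Rightarrow> bool list \<Rightarrow> sym list \<Rightarrow>
    vstate \<Rightarrow> nat \<Rightarrow> nat \<Rightarrow> tape \<Rightarrow> tape list \<Rightarrow> bool" where
  "inv M Q x cw RW i p H ts \<longleftrightarrow> guessed M [] 0 H ts"
| "inv M Q x cw (G u bd) i p H ts \<longleftrightarrow> (\<not> u \<longrightarrow> i = 1) \<and>
     (\<exists>xs w v. v = enc_seq xs @ bits w \<and> guessed M v (length v) H ts \<and> (bd \<longrightarrow> w = []) \<and> (u \<longrightarrow> x \<in> set xs))"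
| "inv M Q x cw Cp i p H ts \<longleftrightarrow>
     (\<exists>xs j v. j \<le> length x \<and> i = Suc j \<and> v = enc_seq xs @ bits (take j x) \<and> guessed M v (length v) H ts)"
| "inv M Q x cw RM i p H ts \<longleftrightarrow> (\<exists>xs j. x \<in> set xs \<and> guessed M (enc_seq xs) j H ts)"
| "inv M Q x cw (Run q) i p H ts \<longleftrightarrow> reach M Q x (q, ts) \<and> length ts = tapes M \<and> H = (cont [Sep], snd (ts ! 1))"
| "inv M Q x cw QL i p H ts \<longleftrightarrow> (\<exists>f j. displaced M Q x f j H ts)"
| "inv M Q x cw QS i p H ts \<longleftrightarrow> (\<exists>f. displaced M Q x f 0 H ts)"
| "inv M Q x cw QC i p H ts \<longleftrightarrow> (\<exists>f j u w v. displaced M Q x f j H ts \<and> cw = u @ Aux 2 # w @ v \<and>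
     p = Suc (length u + length w) \<and> w = map f [0..<j] \<and> set w \<subseteq> {Zero, One, Sep})"
| "inv M Q x cw (QB b) i p H ts \<longleftrightarrow> (\<exists>f j. displaced M Q x f j H ts \<and> (word_on (f, 0) \<in> Q \<longleftrightarrow> b))"
| "inv M Q x cw Acc i p H ts \<longleftrightarrow> (\<exists>c. reach M Q x c \<and> oracle_halted M c \<and> fst c \<noteq> accept M)"
| "inv M Q x cw _ i p H ts \<longleftrightarrow> False"

lemma cont_bits: "cont (Sep # bits x) (Suc j) = (if j < length x then if x ! j then One else Zero else Blank)"
  by (simp add: cont_def bits_def)

lemma cont_bits_Sep: "cont (Sep # bits x) j = Sep \<longleftrightarrow> j = 0"
  by (cases j) (auto simp: cont_bits)

lemma cont_Sep: "cont [Sep] j = Sep \<longleftrightarrow> j = 0"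
  by (simp add: cont_def)

lemma enc_seq_simps: "enc_seq [] = []" "enc_seq (xs @ [w]) = enc_seq xs @ bits w @ [Sep]"
  by (simp_all add: enc_seq_def)

lemma guessed_write:
  assumes "guessed M v (length v) H ts" "ts' = map2 act ((map stay (map read ts))[0 := (s, Right)]) ts"
  shows "guessed M (v @ [s]) (length (v @ [s])) (act (read H, Right) H) ts'"
  using assms by (simp add: guessed_def cont_snoc map2_act_upd del: map_map)

lemma hmark_vals: "hmark j i \<in> {Sep, Zero} \<longleftrightarrow> i = 0" "hmark j i \<in> {One, Zero} \<longleftrightarrow> i = j"
    "(hmark j)(j := unmark (hmark j j)) = cont [Sep]" 
  by (auto simp: hmark_def cont_def fun_eq_iff split: if_splits)

lemma word_on_eq:
  assumes "f j = Blank" "\<And>i. i < j \<Longrightarrow> f i \<noteq> Blank"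
  shows "word_on (f, i) = map f [0..<j]"
proof -
  have "(LEAST i. f i = Blank) = j"
    using assms by (intro Least_equality) (auto simp: not_less[symmetric])
  then show ?thesis by (simp add: word_on_def)
qed

lemma displaced_move:
  assumes "displaced M Q x f i H ts" "tapes M \<ge> 2"
  shows "displaced M Q x f (snd (act (f i, d) (f, i))) (act (read H, d) H)
    (map2 act ((map stay (map read ts))[1 := (map read ts ! 1, d)]) ts)"
proof -
  from assms obtain j where j: "reach M Q x (query M, ts[1 := (f, j)])" "length ts = tapes M" "ts ! 1 = (f, i)"
      "H = (hmark j, i)"
    by (auto simp: displaced_def)
  have "map2 act ((map stay (map read ts))[1 := (map read ts ! 1, d)]) ts = ts[1 := act (f i, d) (f, i)]"
    using j assms(2) by (subst map2_act_upd) (simp_all del: act.simps)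
  then show ?thesis
    using j assms(2) by (auto simp: displaced_def)
qed

text \<open>Every exit from a phase with free movement is guarded by what the heads read:
  \<open>Sep\<close> for a left end, \<open>Aux 2\<close> for the start of an entry, a blank against
  an answer symbol for a completed comparison, the mark for the home position. Hence the invariant
  survives all choices, and \<open>tbl\<close> makes each answer a true one.\<close>

lemma tick_inv:
  assumes t: "tick M (q, W, C, H, ts) (q', W', C', H', ts')"
    and inv: "inv M Q x cw q (snd W) (snd C) H ts"
    and W: "fst W = cont (Sep # bits x)" and C: "fst C = cont cw"
    and M: "wf_oracle_tm M"
    and tbl: "\<And>u w b v. cw = u @ Aux 2 # w @ Aux (of_bool b) # v \<Longrightarrow> set w \<subseteq> {Zero, One, Sep} \<Longrightarrow> w \<in> Q \<longleftrightarrow> b"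
  shows "inv M Q x cw q' (snd W') (snd C') H' ts' \<and> fst W' = fst W \<and> fst C' = fst C"
proof -
  from t obtain aw ac ah as where wk: "work M q (read W) (read C) (read H) (map read ts) q' aw ac ah as"
    and n: "W' = act aw W" "C' = act ac C" "H' = act ah H" "ts' = map2 act as ts"
    by (cases rule: tick.cases) auto
  have k: "tapes M \<ge> 2" using M by (simp add: wf_oracle_tm_def)
  have f: "fst (act (s, d) t) = fst t" if "s = read t" for s d t
    using that by (cases t) simp
  have keep: "fst W' = fst W \<and> fst C' = fst C"
    using wk unfolding n by cases (simp_all only: f)
  have "inv M Q x cw q' (snd W') (snd C') H' ts'"
    using wk
  proof cases
    case RW1
    then show ?thesis using inv by (simp add: n map2_act_stay del: map_map)
  next
    case RW2
    have "snd W = 0" using RW2 W by (simp add: cont_bits_Sep read_eq)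
    then have "snd W' = 1" by (cases W) (simp add: n RW2)
    moreover have "[] = enc_seq [] @ bits []" by (simp add: enc_seq_simps)
    moreover have "guessed M [] (length []) H ts" using inv RW2 by simp
    moreover have "H' = H" "ts' = ts" unfolding n RW2 map2_act_stay act_stay by simp_all
    ultimately show ?thesis unfolding RW2 inv.simps by blast
  next
    case (G_bit s u bd)
    then obtain xs w v where v: "v = enc_seq xs @ bits w" "guessed M v (length v) H ts" "u \<longrightarrow> x \<in> set xs"
      using inv by auto
    have "v @ [s] = enc_seq xs @ bits (w @ [s = One])" using v(1) G_bit by auto
    moreover have "guessed M (v @ [s]) (length (v @ [s])) H' ts'"
      using guessed_write[OF v(2)] by (simp only: n G_bit)
    moreover have "\<not> u \<longrightarrow> snd W' = 1"
      using inv G_bit by (simp add: n)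
    ultimately show ?thesis using v(3) unfolding G_bit inv.simps by blast
  next
    case (G_sep u bd)
    then obtain xs w v where v: "v = enc_seq xs @ bits w" "guessed M v (length v) H ts" "u \<longrightarrow> x \<in> set xs"
      using inv by auto
    have "v @ [Sep] = enc_seq (xs @ [w]) @ bits []" using v(1) by (simp add: enc_seq_simps)
    moreover have "guessed M (v @ [Sep]) (length (v @ [Sep])) H' ts'"
      using guessed_write[OF v(2)] by (simp only: n G_sep)
    moreover have "\<not> u \<longrightarrow> snd W' = 1" "u \<longrightarrow> x \<in> set (xs @ [w])"
      using inv G_sep v(3) by (simp_all add: n)
    ultimately show ?thesis unfolding G_sep inv.simps by blast
  next
    case G_copy
    then obtain xs v where "v = enc_seq xs @ bits (take 0 x)" "guessed M v (length v) H ts" "snd W = Suc 0"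
      using inv by auto
    moreover have "H' = H" "ts' = ts" "W' = W" unfolding n G_copy map2_act_stay act_stay by simp_all
    ultimately show ?thesis unfolding G_copy inv.simps by blast
  next
    case G_end
    then obtain xs where "x \<in> set xs" "guessed M (enc_seq xs) (length (enc_seq xs)) H ts"
      using inv by auto
    moreover have "H' = H" "ts' = ts" unfolding n G_end map2_act_stay act_stay by simp_all
    ultimately show ?thesis unfolding G_end inv.simps by blast
  next
    case Cp1
    then obtain xs j v where v: "j \<le> length x" "snd W = Suc j" "v = enc_seq xs @ bits (take j x)"
        "guessed M v (length v) H ts"
      using inv by auto
    have j: "j < length x" "read W = (if x ! j then One else Zero)"
      using Cp1 v(2) W by (auto simp: cont_bits read_eq split: if_splits)
    have "v @ [read W] = enc_seq xs @ bits (take (Suc j) x)"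
      unfolding v(3) j(2) by (simp add: take_Suc_conv_app_nth j(1))
    moreover have "guessed M (v @ [read W]) (length (v @ [read W])) H' ts'"
      using guessed_write[OF v(4)] by (simp only: n Cp1)
    moreover have "snd W' = Suc (Suc j)" using v(2) by (cases W) (simp add: n Cp1)
    ultimately show ?thesis using j(1) unfolding Cp1 inv.simps by (metis Suc_leI)
  next
    case Cp2
    then obtain xs j v where v: "j \<le> length x" "snd W = Suc j" "v = enc_seq xs @ bits (take j x)"
        "guessed M v (length v) H ts"
      using inv by auto
    have j: "j = length x"
      using Cp2 v(1,2) W by (auto simp: cont_bits read_eq split: if_splits)
    have "v @ [Sep] = enc_seq (xs @ [x]) @ bits []" unfolding v(3) j by (simp add: enc_seq_simps)
    moreover have "guessed M (v @ [Sep]) (length (v @ [Sep])) H' ts'"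
      using guessed_write[OF v(4)] by (simp only: n Cp2)
    moreover have "x \<in> set (xs @ [x])" by simp
    ultimately show ?thesis unfolding Cp2 inv.simps by blast
  next
    case RM1
    then obtain xs j where v: "x \<in> set xs" "guessed M (enc_seq xs) j H ts"
      using inv by auto
    have "guessed M (enc_seq xs) (j - 1) H' ts'"
      using v(2) unfolding n RM1 guessed_def by (subst map2_act_upd) simp_all
    with v(1) show ?thesis unfolding RM1 inv.simps by blast
  next
    case RM2
    then obtain xs j where v: "x \<in> set xs" "guessed M (enc_seq xs) j H ts"
      using inv by auto
    then have "j = 0" using RM2 by (simp add: guessed_def cont_Sep)
    then have "(start M, ts) = init M (enc_seq xs)" "H = (cont [Sep], 0)" "length ts = tapes M" "snd (ts ! 1) = 0"
      using v(2) k by (simp_all add: guessed_def init_def tape_of_cont)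
    moreover have "H' = H" "ts' = ts" using RM2 act_stay[of H] unfolding n RM2 map2_act_stay by simp_all
    ultimately show ?thesis using v(1) unfolding RM2 inv.simps reach_def by auto
  next
    case (Run_step p p')
    have r: "reach M Q x (p, ts)" "length ts = tapes M" "H = (cont [Sep], snd (ts ! 1))"
      using inv Run_step by auto
    have l: "length as = tapes M" using Run_step M by (auto simp: wf_oracle_tm_def wf_tm_def)
    have "ostep M Q (p, ts) (p', ts')"
      using Run_step by (auto simp: ostep_def step.simps n)
    then have "reach M Q x (p', ts')"
      using r(1) unfolding reach_def by (meson rtranclp.rtrancl_into_rtrancl)
    moreover have "H' = (cont [Sep], snd (ts' ! 1))"
      using r(2) l k by (cases "ts ! 1"; cases "as ! 1") (simp add: n Run_step r(3))
    moreover have "length ts' = tapes M" using r(2) l by (simp add: n)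
    ultimately show ?thesis by (simp add: Run_step)
  next
    case (Run_halt p)
    have "reach M Q x (p, ts)" using inv Run_halt by simp
    moreover have "oracle_halted M (p, ts)" using Run_halt by (auto simp: oracle_halted_def step.simps)
    ultimately show ?thesis using Run_halt by auto
  next
    case Run_ask
    have r: "reach M Q x (query M, ts)" "length ts = tapes M" "H = (cont [Sep], snd (ts ! 1))"
      using inv Run_ask by auto
    have "displaced M Q x (fst (ts ! 1)) (snd (ts ! 1)) H' ts'"
      unfolding displaced_def n Run_ask map2_act_stay using r
      by (intro exI[of _ "snd (ts ! 1)"]) (simp add: hmark_def)
    then show ?thesis unfolding Run_ask inv.simps by blast
  next
    case QL1
    then obtain f j where "displaced M Q x f j H ts" using inv by auto
    from displaced_move[OF this k] show ?thesis unfolding n QL1 inv.simps by blast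
  next
    case QL2
    then obtain f j where d: "displaced M Q x f j H ts" using inv by auto
    then obtain i where "H = (hmark i, j)" by (auto simp: displaced_def)
    then have "hmark i j \<in> {Sep, Zero}" using QL2 by (simp add: read_eq)
    then have "j = 0" by (simp only: hmark_vals)
    moreover have "H' = H" "ts' = ts" unfolding n QL2 map2_act_stay act_stay by simp_all
    ultimately show ?thesis using d unfolding QL2 inv.simps by blast
  next
    case (QS1 d)
    have "H' = H" "ts' = ts" unfolding n QS1 map2_act_stay act_stay by simp_all
    then show ?thesis using inv by (simp add: QS1)
  next
    case QS2
    obtain f where f: "displaced M Q x f 0 H ts" using inv QS2 by auto
    have p: "cont cw (snd C) = Aux 2" using QS2 C by (simp add: read_eq)
    then have "snd C < length cw" by (simp add: cont_def split: if_splits)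
    then have "cw = take (snd C) cw @ Aux 2 # [] @ drop (Suc (snd C)) cw" "length (take (snd C) cw) = snd C"
      using p id_take_nth_drop[of "snd C" cw] by (simp_all add: cont_def)
    moreover have "snd C' = Suc (snd C)" by (cases C) (simp add: n QS2)
    moreover have "H' = H" "ts' = ts" unfolding n QS2 map2_act_stay act_stay by simp_all
    ultimately show ?thesis using f unfolding QS2 inv.simps
      by (intro exI[of _ f] exI[of _ 0] exI[of _ "take (snd C) cw"] exI[of _ "[]"] exI[of _ "drop (Suc (snd C)) cw"]) simp
  next
    case QC1
    then obtain f j u w v where d: "displaced M Q x f j H ts" and c: "cw = u @ Aux 2 # w @ v"
        "snd C = Suc (length u + length w)" "w = map f [0..<j]" "set w \<subseteq> {Zero, One, Sep}"
      using inv by auto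
    let ?c = "read C"
    have "cont cw (snd C) = ?c" using C by (simp add: read_eq)
    with QC1 c(1,2) obtain v' where v: "v = ?c # v'"
      by (cases v) (auto simp: cont_def nth_append)
    have c': "map read ts ! 1 = ?c" "?c \<in> {Zero, One, Sep}" using QC1 by auto
    have "map read ts ! 1 = f j" using d k by (auto simp: displaced_def)
    then have "f j = ?c" using c'(1) by simp
    then have "w @ [?c] = map f [0..<Suc j]" using c(3) by simp
    moreover have "cw = u @ Aux 2 # (w @ [?c]) @ v'" using c(1) v by simp
    moreover have "snd C' = Suc (length u + length (w @ [?c]))" using c(2) by (cases C) (simp add: n QC1)
    moreover have "displaced M Q x f (Suc j) H' ts'"
      using displaced_move[OF d k, of Right] unfolding n QC1(1-6) c'(1) by simp
    moreover have "set (w @ [?c]) \<subseteq> {Zero, One, Sep}" using c(4) c'(2) by simp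
    ultimately show ?thesis unfolding QC1(2) inv.simps by blast
  next
    case (QC2 b)
    then obtain f j u w v where d: "displaced M Q x f j H ts" and c: "cw = u @ Aux 2 # w @ v"
        "snd C = Suc (length u + length w)" "w = map f [0..<j]" "set w \<subseteq> {Zero, One, Sep}"
      using inv by auto
    have "cont cw (snd C) = Aux (of_bool b)" using C QC2 by (simp add: read_eq)
    with c(1,2) obtain v' where v: "v = Aux (of_bool b) # v'"
      by (cases v) (auto simp: cont_def nth_append)
    have "map read ts ! 1 = f j" using d k by (auto simp: displaced_def)
    then have "f j = Blank" using QC2 by simp
    moreover have "f i \<noteq> Blank" if "i < j" for i
    proof -
      have "f i \<in> set w" using c(3) that by simp
      then have "f i \<in> {Zero, One, Sep}" using c(4) by blast
      then show ?thesis by auto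
    qed
    \<comment> \<open>The cells below \<open>j\<close> matched non-blank symbols and cell
      \<open>j\<close> is blank, so \<open>w\<close> is the entire query and not merely a prefix of
      it.\<close>
    ultimately have "word_on (f, 0) = w" using c(3) by (simp add: word_on_eq)
    with tbl[of u w b v'] c v have "word_on (f, 0) \<in> Q \<longleftrightarrow> b" by simp
    moreover have "H' = H" "ts' = ts" unfolding n QC2(1-6) map2_act_stay act_stay by simp_all
    ultimately show ?thesis using d unfolding QC2(2) inv.simps by blast
  next
    case (QB1 b d)
    then obtain f j where "displaced M Q x f j H ts" "word_on (f, 0) \<in> Q \<longleftrightarrow> b" using inv by auto
    with displaced_move[OF _ k] show ?thesis unfolding n QB1 inv.simps by blast
  next
    case (QB2 b)
    then obtain f i where d: "displaced M Q x f i H ts" and b: "word_on (f, 0) \<in> Q \<longleftrightarrow> b" using inv by auto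
    then obtain j where j: "reach M Q x (query M, ts[1 := (f, j)])" "length ts = tapes M" "ts ! 1 = (f, i)"
      "H = (hmark j, i)" by (auto simp: displaced_def)
    have "hmark j i \<in> {One, Zero}" using QB2 j(4) by simp
    \<comment> \<open>The mark sits only at the home position, so the query head is back where the
      simulated machine had it.\<close>
    then have ij: "i = j" by (simp only: hmark_vals)
    then have "ts[1 := (f, j)] = ts" using j(3) by (metis list_update_id)
    then have "reach M Q x (query M, ts)" using j(1) by simp
    moreover have "ostep M Q (query M, ts) (if b then yes M else no M, ts)"
      using b j(3) by (simp add: ostep_def word_on_def)
    ultimately have "reach M Q x (if b then yes M else no M, ts)"
      unfolding reach_def by (meson rtranclp.rtrancl_into_rtrancl)
    moreover have "ts' = ts" unfolding n QB2 map2_act_stay by simp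
    moreover have "H' = (cont [Sep], snd (ts ! 1))"
      using hmark_vals(3)[of j] j(3) by (simp add: n QB2 j(4) ij)
    ultimately show ?thesis using j(2) by (simp add: QB2)
  qed
  with keep show ?thesis by blast
qed

definition winv :: "(nat, 'm) oracle_tm_scheme \<Rightarrow> sym list set \<Rightarrow> bool list \<Rightarrow> sym list \<Rightarrow> wconfig \<Rightarrow> bool" where
  "winv M Q x cw = (\<lambda>(q, W, C, H, ts).
    inv M Q x cw q (snd W) (snd C) H ts \<and> fst W = cont (Sep # bits x) \<and> fst C = cont cw)"

text \<open>An accepting run exhibits a sequence containing \<open>x\<close> on which the oracle
  machine halts without accepting. That halting configuration is unique, hence the one given by
  \<open>run\<close>, which would be accepting if \<open>x \<in> L\<close>.\<close>

lemma verifier_sound: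
  assumes M: "wf_oracle_tm M" "deterministic M"
    and tbl: "\<And>y b. (y, b) \<in> set es \<Longrightarrow> enc_inst y \<in> Q \<longleftrightarrow> b"
    and run: "\<And>xs. x \<in> set xs \<Longrightarrow> \<exists>c. (ostep M Q)\<^sup>*\<^sup>* (init M (enc_seq xs)) c \<and> oracle_halted M c \<and>
      (x \<in> L \<longrightarrow> fst c = accept M)"
    and acc: "acc_from (verifier M) (with_input p f (loaded M x (table es)))"
  shows "x \<notin> L"
proof -
  have T: "w \<in> Q \<longleftrightarrow> b"
    if "table es = u @ Aux 2 # w @ Aux (of_bool b) # v" "set w \<subseteq> {Zero, One, Sep}" for u w b v
    using table_entry[OF that] tbl by blast
  obtain c where c: "(step (verifier M))\<^sup>*\<^sup>* (with_input p f (loaded M x (table es))) c" "fst c = Acc"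
    using acc by (auto simp: acc_from_def verifier_def)
  from c(1) have "\<exists>p b. c = with_input p f b \<and> \<not> loading (fst b) \<and> winv M Q x (table es) b"
  proof (induction rule: rtranclp_induct)
    case base
    have "winv M Q x (table es) (loaded M x (table es))"
      using M(1) by (cases "tapes M") (auto simp: winv_def loaded_def guessed_def wf_oracle_tm_def)
    moreover have "\<not> loading (fst (loaded M x (table es)))"
      by (auto simp: loaded_def loading_def)
    ultimately show ?case by blast
  next
    case (step y z)
    from step.IH obtain p a where a: "y = with_input p f a" "\<not> loading (fst a)" "winv M Q x (table es) a"
      by blast
    from step_tick[OF step.hyps(2)[unfolded a(1)] a(2)] obtain b
      where b: "z = with_input (Suc p) f b" "tick M a b" "\<not> loading (fst b)" by blast
    obtain q W C H ts where qa: "a = (q, W, C, H, ts)" by (cases a)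
    obtain q' W' C' H' ts' where qb: "b = (q', W', C', H', ts')" by (cases b)
    have "winv M Q x (table es) b"
    proof -
      have i: "inv M Q x (table es) q (snd W) (snd C) H ts" "fst W = cont (Sep # bits x)" "fst C = cont (table es)"
        using a(3) by (simp_all add: qa winv_def)
      have "inv M Q x (table es) q' (snd W') (snd C') H' ts' \<and> fst W' = fst W \<and> fst C' = fst C"
        using b(2) unfolding qa qb by (rule tick_inv[OF _ i M(1) T])
      then show ?thesis by (simp add: qb winv_def i)
    qed
    with b show ?case by blast
  qed
  then obtain b p where "c = with_input p f b" "winv M Q x (table es) b" by blast
  with c(2) obtain d where "reach M Q x d" "oracle_halted M d" "fst d \<noteq> accept M"
    by (cases b) (auto simp: with_input_def winv_def)
  then obtain xs where xs: "x \<in> set xs" "(ostep M Q)\<^sup>*\<^sup>* (init M (enc_seq xs)) d"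
    by (auto simp: reach_def)
  from run[OF xs(1)] obtain c' where c': "(ostep M Q)\<^sup>*\<^sup>* (init M (enc_seq xs)) c'" "oracle_halted M c'"
      "x \<in> L \<longrightarrow> fst c' = accept M" by blast
  have "c' = d"
    using osteps_halted_unique[OF M(2) c'(1,2) xs(2) \<open>oracle_halted M d\<close>] .
  with c'(3) \<open>fst d \<noteq> accept M\<close> show ?thesis by blast
qed

section \<open>Completeness of the simulation\<close>

text \<open>Upper bounds suffice: an accepting configuration has no successor, so padding left over
  at that point does no harm.\<close>

definition ticks_within :: "(nat, 'm) oracle_tm_scheme \<Rightarrow> nat \<Rightarrow> wconfig \<Rightarrow> wconfig \<Rightarrow> bool" where
  "ticks_within M n a b \<longleftrightarrow> (\<exists>m \<le> n. (tick M ^^ m) a b)"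

lemma ticks_within_refl: "ticks_within M n a a"
  unfolding ticks_within_def by (intro exI[of _ 0]) simp

lemma ticks_within_trans: "ticks_within M m a b \<Longrightarrow> ticks_within M n b c \<Longrightarrow> m + n = k \<Longrightarrow> ticks_within M k a c"
  unfolding ticks_within_def
proof (elim exE conjE)
  fix i j
  assume "(tick M ^^ i) a b" "(tick M ^^ j) b c"
  then have "(tick M ^^ (i + j)) a c" unfolding relpowp_add by (rule relcomppI)
  moreover assume "i \<le> m" "j \<le> n" "m + n = k"
  ultimately show "\<exists>l \<le> k. (tick M ^^ l) a c" by (intro exI[of _ "i + j"]) simp
qed

lemma ticks_within_1: "tick M a b \<Longrightarrow> ticks_within M 1 a b"
  unfolding ticks_within_def by (intro exI[of _ 1]) (simp only: relpowp_1 order_refl simp_thms)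

lemma ticks_within_mono: "ticks_within M m a b \<Longrightarrow> m \<le> n \<Longrightarrow> ticks_within M n a b"
  unfolding ticks_within_def by (meson le_trans)

lemma tickI:
  assumes "work M q (read W) (read C) (read H) (map read ts) q' aw ac ah as"
    "W' = act aw W" "C' = act ac C" "H' = act ah H" "ts' = map2 act as ts"
  shows "tick M (q, W, C, H, ts) (q', W', C', H', ts')"
  unfolding assms(2-) using assms(1) by (rule tick.intros)

section \<open>Time for guessing the tuple\<close>

lemma tick_rewind_word:
  "ticks_within M (Suc i) (RW, (cont (Sep # bits x), i), C, H, ts) (G False True, (cont (Sep # bits x), 1), C, H, ts)"
proof (induction i)
  case 0
  have "tick M (RW, (cont (Sep # bits x), 0), C, H, ts) (G False True, (cont (Sep # bits x), 1), C, H, ts)"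
    by (rule tickI, unfold read.simps cont_0, rule RW2) (simp_all add: map2_act_stay del: map_map)
  then show ?case using ticks_within_1 by fastforce
next
  case (Suc i)
  have w: "cont (Sep # bits x) (Suc i) \<noteq> Sep" by (simp add: cont_bits_Sep)
  have "tick M (RW, (cont (Sep # bits x), Suc i), C, H, ts) (RW, (cont (Sep # bits x), i), C, H, ts)"
    by (rule tickI, unfold read.simps, rule RW1[OF w]) (simp_all add: map2_act_stay del: map_map)
  from ticks_within_trans[OF ticks_within_1[OF this] Suc] show ?case by simp
qed

definition guess_config :: "(nat, 'm) oracle_tm_scheme \<Rightarrow> vstate \<Rightarrow> tape \<Rightarrow> tape \<Rightarrow> sym list \<Rightarrow> nat \<Rightarrow> wconfig" where
  "guess_config M q W C v i = (q, W, C, (cont [Sep], i), (cont v, i) # replicate (tapes M - 1) (cont [], 0))"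

lemma guess_write:
  assumes "work M q (read W) (read C) (cont [Sep] (length v)) (cont v (length v) # replicate (tapes M - 1) Blank) q' aw (stay (read C))
    (cont [Sep] (length v), Right) ((map stay (cont v (length v) # replicate (tapes M - 1) Blank))[0 := (s, Right)])"
  shows "tick M (guess_config M q W C v (length v)) (guess_config M q' (act aw W) C (v @ [s]) (length (v @ [s])))"
proof -
  have r: "map read ((cont v, i) # replicate (tapes M - 1) (cont [], 0)) = cont v i # replicate (tapes M - 1) Blank" for i
    by (simp add: cont_def)
  have "guessed M v (length v) (cont [Sep], length v) ((cont v, length v) # replicate (tapes M - 1) (cont [], 0))"
    by (simp add: guessed_def)
  from guessed_write[OF this HOL.refl, of s] show ?thesis
    unfolding guess_config_def guessed_def using assms
    by (intro tickI[where aw = aw and ac = "stay (read C)" and ah = "(cont [Sep] (length v), Right)"])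
      (unfold r read.simps, assumption, simp_all del: act.simps)
qed

lemma guess_G:
  assumes "s \<in> {Zero, One, Sep}"
  shows "tick M (guess_config M (G u bd) W C v (length v)) (guess_config M (G u (s = Sep)) W C (v @ [s]) (length (v @ [s])))"
proof -
  have "tick M (guess_config M (G u bd) W C v (length v)) (guess_config M (G u (s = Sep)) (act (stay (read W)) W) C (v @ [s]) (length (v @ [s])))"
  proof (cases "s = Sep")
    case True
    then show ?thesis using guess_write[OF G_sep] by simp
  next
    case False
    with assms have "s \<in> {Zero, One}" by simp
    then show ?thesis using guess_write[OF G_bit[of s]] False by simp
  qed
  then show ?thesis unfolding act_stay .
qed

lemma guess_word:
  assumes "set w \<subseteq> {Zero, One, Sep}"
  shows "ticks_within M (length w) (guess_config M (G u bd) W C v (length v))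
    (guess_config M (G u (if w = [] then bd else last w = Sep)) W C (v @ w) (length (v @ w)))"
  using assms
proof (induction w rule: rev_induct)
  case Nil
  then show ?case by (simp add: ticks_within_refl)
next
  case (snoc s w)
  have "tick M (guess_config M (G u (if w = [] then bd else last w = Sep)) W C (v @ w) (length (v @ w)))
      (guess_config M (G u (s = Sep)) W C ((v @ w) @ [s]) (length ((v @ w) @ [s])))"
    using snoc.prems by (intro guess_G) simp
  from ticks_within_trans[OF snoc.IH ticks_within_1[OF this]] snoc.prems show ?case by simp
qed

lemma enc_seq_set: "set (enc_seq xs) \<subseteq> {Zero, One, Sep}"
  by (auto simp: enc_seq_def bits_def)

lemma enc_seq_last: "xs \<noteq> [] \<Longrightarrow> enc_seq xs \<noteq> [] \<and> last (enc_seq xs) = Sep"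
  by (cases xs rule: rev_cases) (auto simp: enc_seq_def)

lemma guess_seq:
  "ticks_within M (length (enc_seq xs)) (guess_config M (G u True) W C v (length v))
    (guess_config M (G u True) W C (v @ enc_seq xs) (length (v @ enc_seq xs)))"
  using guess_word[OF enc_seq_set[of xs], of M u True W C v] enc_seq_last[of xs]
  by (cases "xs = []") (simp_all add: enc_seq_def)

lemma guess_copy:
  "j \<le> length x \<Longrightarrow> ticks_within M j (guess_config M Cp (cont (Sep # bits x), Suc 0) C v (length v))
    (guess_config M Cp (cont (Sep # bits x), Suc j) C (v @ bits (take j x)) (length (v @ bits (take j x))))"
proof (induction j)
  case 0
  then show ?case by (simp add: ticks_within_refl)
next
  case (Suc j)
  let ?W = "(cont (Sep # bits x), Suc j)" and ?v = "v @ bits (take j x)"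
  let ?s = "read ?W"
  have s: "?s = (if x ! j then One else Zero)" using Suc.prems by (simp add: cont_bits)
  have w: "work M Cp ?s c h rs Cp (?s, Right) (stay c) (h, Right) ((map stay rs)[0 := (?s, Right)])" for c h rs
    using s by (intro Cp1) simp
  have "tick M (guess_config M Cp ?W C ?v (length ?v)) (guess_config M Cp (act (?s, Right) ?W) C (?v @ [?s]) (length (?v @ [?s])))"
    by (rule guess_write, rule w)
  moreover have "act (?s, Right) ?W = (cont (Sep # bits x), Suc (Suc j))" by simp
  moreover have "?v @ [?s] = v @ bits (take (Suc j) x)"
    using Suc.prems unfolding s by (simp add: take_Suc_conv_app_nth)
  ultimately have "tick M (guess_config M Cp ?W C ?v (length ?v))
      (guess_config M Cp (cont (Sep # bits x), Suc (Suc j)) C (v @ bits (take (Suc j) x)) (length (v @ bits (take (Suc j) x))))"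
    by (simp only:)
  from ticks_within_trans[OF Suc.IH ticks_within_1[OF this]] Suc.prems show ?case by simp
qed

lemma tick_stay:
  assumes "\<And>w c h rs. work M q w c h rs q' (stay w) (stay c) (stay h) (map stay rs)"
  shows "tick M (q, W, C, H, ts) (q', W, C, H, ts)"
  by (rule tickI, rule assms) (simp_all only: act_stay map2_act_stay)

text \<open>One occurrence of \<open>x\<close> is copied from the work tape, and the components
  before and after it are guessed symbol by symbol.\<close>

lemma guess_guess:
  assumes "x \<in> set xs"
  shows "\<exists>i. ticks_within M (length (enc_seq xs) + 2) (guess_config M (G False True) (cont (Sep # bits x), Suc 0) C [] 0)
    (guess_config M RM (cont (Sep # bits x), i) C (enc_seq xs) (length (enc_seq xs)))"
proof -
  obtain ys zs where xs: "xs = ys @ x # zs" using split_list[OF assms] by blast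
  let ?W = "\<lambda>i. (cont (Sep # bits x), Suc i)"
  let ?v1 = "enc_seq ys @ bits x"
  let ?v2 = "?v1 @ [Sep]"
  let ?v3 = "?v2 @ enc_seq zs"
  have v3: "?v3 = enc_seq xs" by (simp add: xs enc_seq_def)
  have 1: "ticks_within M (length (enc_seq ys)) (guess_config M (G False True) (?W 0) C [] 0)
      (guess_config M (G False True) (?W 0) C (enc_seq ys) (length (enc_seq ys)))"
    using guess_seq[of M ys False "?W 0" C "[]"] by simp
  have 2: "tick M (guess_config M (G False True) (?W 0) C (enc_seq ys) (length (enc_seq ys)))
      (guess_config M Cp (?W 0) C (enc_seq ys) (length (enc_seq ys)))"
    unfolding guess_config_def by (rule tick_stay) (rule G_copy)
  have 3: "ticks_within M (length x) (guess_config M Cp (?W 0) C (enc_seq ys) (length (enc_seq ys)))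
      (guess_config M Cp (?W (length x)) C ?v1 (length ?v1))"
    using guess_copy[of "length x" x M C "enc_seq ys"] by simp
  have b: "read (?W (length x)) = Blank" by (simp add: cont_bits)
  have 4: "tick M (guess_config M Cp (?W (length x)) C ?v1 (length ?v1)) (guess_config M (G True True) (?W (length x)) C ?v2 (length ?v2))"
  proof -
    have "tick M (guess_config M Cp (?W (length x)) C ?v1 (length ?v1))
        (guess_config M (G True True) (act (stay (read (?W (length x)))) (?W (length x))) C ?v2 (length ?v2))"
      by (rule guess_write) (unfold b, rule Cp2)
    then show ?thesis unfolding act_stay .
  qed
  have 5: "ticks_within M (length (enc_seq zs)) (guess_config M (G True True) (?W (length x)) C ?v2 (length ?v2))
      (guess_config M (G True True) (?W (length x)) C ?v3 (length ?v3))"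
    by (rule guess_seq)
  have 6: "tick M (guess_config M (G True True) (?W (length x)) C ?v3 (length ?v3)) (guess_config M RM (?W (length x)) C ?v3 (length ?v3))"
    unfolding guess_config_def by (rule tick_stay) (rule G_end)
  \<comment> \<open>Every step writes one symbol of the encoded sequence, the end of the copy paying
    for the separator; only entering the copy phase and ending the guess write nothing.\<close>
  have l: "length (enc_seq ys) + (1 + (length x + (1 + (length (enc_seq zs) + 1)))) = length (enc_seq xs) + 2"
    by (simp add: xs enc_seq_def)
  have "ticks_within M (length (enc_seq xs) + 2) (guess_config M (G False True) (?W 0) C [] 0)
      (guess_config M RM (?W (length x)) C ?v3 (length ?v3))"
    unfolding l[symmetric]
    by (intro ticks_within_trans[OF 1 _ HOL.refl] ticks_within_trans[OF ticks_within_1[OF 2] _ HOL.refl] ticks_within_trans[OF 3 _ HOL.refl]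
        ticks_within_trans[OF ticks_within_1[OF 4] _ HOL.refl] ticks_within_trans[OF 5 ticks_within_1[OF 6] HOL.refl])
  then show ?thesis unfolding v3 by blast
qed

lemma guess_rewind:
  "ticks_within M (Suc i) (guess_config M RM W C v i) (guess_config M (Run (start M)) W C v 0)"
proof (induction i)
  case 0
  have "tick M (guess_config M RM W C v 0) (guess_config M (Run (start M)) W C v 0)"
    unfolding guess_config_def
    by (rule tickI, unfold read.simps cont_0, rule RM2) (simp_all add: map2_act_stay del: map_map)
  then show ?case using ticks_within_1 by fastforce
next
  case (Suc i)
  have h: "cont [Sep] (Suc i) \<noteq> Sep" by (simp add: cont_Sep)
  have "tick M (guess_config M RM W C v (Suc i)) (guess_config M RM W C v i)"
    unfolding guess_config_def
    by (rule tickI, unfold read.simps, rule RM1[OF h]) (simp_all add: map2_act_upd map2_act_stay del: map_map)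
  from ticks_within_trans[OF ticks_within_1[OF this] Suc] show ?case by simp
qed

section \<open>Time for answering one query\<close>

lemma query_move:
  assumes "length ts \<ge> 2"
  shows "map2 act ((map stay (map read (ts[1 := (f, i)])))[1 := (f i, d)]) (ts[1 := (f, i)]) = ts[1 := (f, snd (act (f i, d) (f, i)))]"
  using assms by (subst map2_act_upd) (simp_all)

lemma tick_QL:
  assumes "length ts \<ge> 2"
  shows "ticks_within M (Suc i) (QL, W, C, (hmark j, i), ts[1 := (f, i)]) (QS, W, C, (hmark j, 0), ts[1 := (f, 0)])"
proof (induction i)
  case 0
  have h: "hmark j 0 \<in> {Sep, Zero}" by (simp only: hmark_vals)
  have "tick M (QL, W, C, (hmark j, 0), ts[1 := (f, 0)]) (QS, W, C, (hmark j, 0), ts[1 := (f, 0)])"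
    by (rule tickI, unfold read.simps, rule QL2[OF h]) (simp_all add: map2_act_stay del: map_map)
  then show ?case using ticks_within_1 by fastforce
next
  case (Suc i)
  have h: "hmark j (Suc i) \<notin> {Sep, Zero}" by (simp only: hmark_vals)
  have r: "map read (ts[1 := (f, Suc i)]) ! 1 = f (Suc i)" using assms by simp
  have "tick M (QL, W, C, (hmark j, Suc i), ts[1 := (f, Suc i)]) (QL, W, C, (hmark j, i), ts[1 := (f, i)])"
    by (rule tickI, unfold read.simps, rule QL1[OF h]) (simp_all only: act_stay r query_move[OF assms], simp_all)
  from ticks_within_trans[OF ticks_within_1[OF this] Suc] show ?case by simp
qed

lemma tick_QS_Left: "ticks_within M n (QS, W, (f, p + n), H, ts) (QS, W, (f, p), H, ts)"
proof (induction n)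
  case 0
  then show ?case by (simp add: ticks_within_refl)
next
  case (Suc n)
  have "tick M (QS, W, (f, p + Suc n), H, ts) (QS, W, (f, p + n), H, ts)"
    by (rule tickI, unfold read.simps, rule QS1[where d = Left]) (simp_all add: map2_act_stay del: map_map)
  from ticks_within_trans[OF ticks_within_1[OF this] Suc] show ?case by simp
qed

lemma tick_QS_Right: "ticks_within M n (QS, W, (f, p), H, ts) (QS, W, (f, p + n), H, ts)"
proof (induction n)
  case 0
  then show ?case by (simp add: ticks_within_refl)
next
  case (Suc n)
  have "tick M (QS, W, (f, p + n), H, ts) (QS, W, (f, p + Suc n), H, ts)"
    by (rule tickI, unfold read.simps, rule QS1[where d = Right]) (simp_all add: map2_act_stay del: map_map)
  from ticks_within_trans[OF Suc ticks_within_1[OF this]] show ?case by simp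
qed

lemma tick_QS:
  assumes "p \<le> n" "p' \<le> n"
  shows "ticks_within M n (QS, W, (f, p), H, ts) (QS, W, (f, p'), H, ts)"
proof (cases "p \<le> p'")
  case True
  then show ?thesis using tick_QS_Right[of M "p' - p" W f p H ts] assms by (auto elim: ticks_within_mono)
next
  case False
  then show ?thesis using tick_QS_Left[of M "p - p'" W f p' H ts] assms by (auto elim: ticks_within_mono)
qed

lemma tick_QB_Left:
  assumes "length ts \<ge> 2"
  shows "ticks_within M n (QB b, W, C, (h, i + n), ts[1 := (f, i + n)]) (QB b, W, C, (h, i), ts[1 := (f, i)])"
proof (induction n)
  case 0
  then show ?case by (simp add: ticks_within_refl)
next
  case (Suc n)
  have r: "map read (ts[1 := (f, i + Suc n)]) ! 1 = f (i + Suc n)" using assms by simp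
  have "tick M (QB b, W, C, (h, i + Suc n), ts[1 := (f, i + Suc n)]) (QB b, W, C, (h, i + n), ts[1 := (f, i + n)])"
    by (rule tickI, unfold read.simps, rule QB1[where d = Left])
      (simp_all only: act_stay r query_move[OF assms], simp_all)
  from ticks_within_trans[OF ticks_within_1[OF this] Suc] show ?case by simp
qed

lemma tick_QB_Right:
  assumes "length ts \<ge> 2"
  shows "ticks_within M n (QB b, W, C, (h, i), ts[1 := (f, i)]) (QB b, W, C, (h, i + n), ts[1 := (f, i + n)])"
proof (induction n)
  case 0
  then show ?case by (simp add: ticks_within_refl)
next
  case (Suc n)
  have r: "map read (ts[1 := (f, i + n)]) ! 1 = f (i + n)" using assms by simp
  have "tick M (QB b, W, C, (h, i + n), ts[1 := (f, i + n)]) (QB b, W, C, (h, i + Suc n), ts[1 := (f, i + Suc n)])"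
    by (rule tickI, unfold read.simps, rule QB1[where d = Right])
      (simp_all only: act_stay r query_move[OF assms], simp_all)
  from ticks_within_trans[OF Suc ticks_within_1[OF this]] show ?case by simp
qed

lemma tick_QB:
  assumes "length ts \<ge> 2" "i \<le> n" "i' \<le> n"
  shows "ticks_within M n (QB b, W, C, (h, i), ts[1 := (f, i)]) (QB b, W, C, (h, i'), ts[1 := (f, i')])"
proof (cases "i \<le> i'")
  case True
  then show ?thesis using tick_QB_Right[OF assms(1), of M "i' - i" b W C h i f] assms by (auto elim: ticks_within_mono)
next
  case False
  then show ?thesis using tick_QB_Left[OF assms(1), of M "i - i'" b W C h i' f] assms by (auto elim: ticks_within_mono)
qed

lemma tick_QC:
  assumes "length ts \<ge> 2" "set w \<subseteq> {Zero, One, Sep}" "l \<le> length w" "\<And>k. k < length w \<Longrightarrow> f k = w ! k"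
  shows "ticks_within M l (QC, W, (cont (u @ w @ v), length u), (h, 0), ts[1 := (f, 0)])
    (QC, W, (cont (u @ w @ v), length u + l), (h, l), ts[1 := (f, l)])"
  using assms(3)
proof (induction l)
  case 0
  then show ?case by (simp add: ticks_within_refl)
next
  case (Suc l)
  let ?C = "cont (u @ w @ v)"
  have C: "?C (length u + l) = f l" "f l \<in> {Zero, One, Sep}"
    using Suc.prems assms(4)[of l] subsetD[OF assms(2) nth_mem[of l]] by (simp_all add: cont_def nth_append)
  have r: "map read (ts[1 := (f, l)]) ! 1 = f l" using assms by simp
  have t: "tick M (QC, W, (?C, length u + l), (h, l), ts[1 := (f, l)])
      (QC, W, (?C, length u + Suc l), (h, Suc l), ts[1 := (f, Suc l)])"
    by (rule tickI, unfold read.simps, rule QC1) (unfold C(1), rule C(2), rule r,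
      simp_all only: act_stay query_move[OF assms(1)], simp_all add: C(1)[symmetric])
  have "ticks_within M l (QC, W, (?C, length u), (h, 0), ts[1 := (f, 0)]) (QC, W, (?C, length u + l), (h, l), ts[1 := (f, l)])"
    using Suc by simp
  from ticks_within_trans[OF this ticks_within_1[OF t]] show ?case by simp
qed

text \<open>With \<open>l\<close> the length of the query, the eight stages take at most 1, i + 1,
  N, 1, l, 1, l + i and 1 steps, in total N + 2l + 2i + 5, and l \<le> N. The assumption
  \<open>blank\<close> ensures that the \<open>LEAST\<close> in \<open>word_on\<close> really is a
  blank cell.\<close>

lemma tick_query:
  assumes len: "length ts \<ge> 2" and ts: "ts ! 1 = (f, i)" and w: "word_on (f, i) = enc_inst y"
    and blank: "\<exists>k. f k = Blank" and es: "(y, b) \<in> set es" and p: "p \<le> length (table es)"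
  defines "N \<equiv> length (table es)"
  shows "\<exists>p' \<le> N. ticks_within M (3 * N + 2 * i + 5)
    (Run (query M), W, (cont (table es), p), (cont [Sep], i), ts)
    (Run (if b then yes M else no M), W, (cont (table es), p'), (cont [Sep], i), ts)"
proof -
  define l where "l = length (enc_inst y)"
  let ?C = "cont (table es)"
  obtain as bs where es': "es = as @ (y, b) # bs" using split_list[OF es] by blast
  let ?u = "table as" and ?v = "Aux (of_bool b) # table bs"
  have tb: "table es = ?u @ Aux 2 # enc_inst y @ ?v" by (simp add: es' table_def entry_def)
  then have tb': "table es = (?u @ [Aux 2]) @ enc_inst y @ ?v" by simp
  have N: "N = length ?u + l + 2 + length (table bs)" by (simp add: N_def tb l_def)
  define k where "k = (LEAST k. f k = Blank)"
  have k: "f k = Blank" unfolding k_def by (rule LeastI_ex[OF blank])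
  have wk: "enc_inst y = map f [0..<k]" using w by (simp add: word_on_def k_def)
  then have lk: "l = k" by (simp add: l_def)
  have fw: "f j = enc_inst y ! j" if "j < length (enc_inst y)" for j using that by (simp add: wk)
  have ts1: "ts[1 := (f, i)] = ts" using ts by (metis list_update_id)
  have 1: "tick M (Run (query M), W, (?C, p), (cont [Sep], i), ts) (QL, W, (?C, p), (hmark i, i), ts[1 := (f, i)])"
    unfolding ts1 by (rule tickI, rule Run_ask) (simp_all only: act_stay map2_act_stay, simp add: hmark_def)
  have 2: "ticks_within M (Suc i) (QL, W, (?C, p), (hmark i, i), ts[1 := (f, i)]) (QS, W, (?C, p), (hmark i, 0), ts[1 := (f, 0)])"
    by (rule tick_QL[OF len])
  have 3: "ticks_within M N (QS, W, (?C, p), (hmark i, 0), ts[1 := (f, 0)]) (QS, W, (?C, length ?u), (hmark i, 0), ts[1 := (f, 0)])"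
    using p by (intro tick_QS) (simp_all add: N_def N[unfolded N_def])
  have r: "read (?C, length ?u) = Aux 2" by (simp add: tb)
  have 4: "tick M (QS, W, (?C, length ?u), (hmark i, 0), ts[1 := (f, 0)])
      (QC, W, (?C, length (?u @ [Aux 2])), (hmark i, 0), ts[1 := (f, 0)])"
    by (rule tickI, unfold r, rule QS2) (simp_all only: act_stay map2_act_stay, simp add: tb)
  have 5: "ticks_within M l (QC, W, (?C, length (?u @ [Aux 2])), (hmark i, 0), ts[1 := (f, 0)])
     (QC, W, (?C, length (?u @ [Aux 2]) + l), (hmark i, l), ts[1 := (f, l)])"
    unfolding tb' l_def by (rule tick_QC[OF len set_enc_inst order_refl fw])
  have r1: "map read (ts[1 := (f, l)]) ! 1 = Blank" using len k by (simp add: lk)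
  have r2: "read (?C, length (?u @ [Aux 2]) + l) = Aux (of_bool b)"
    unfolding tb' l_def by (simp add: cont_def nth_append)
  have 6: "tick M (QC, W, (?C, length (?u @ [Aux 2]) + l), (hmark i, l), ts[1 := (f, l)])
     (QB b, W, (?C, length (?u @ [Aux 2]) + l), (hmark i, l), ts[1 := (f, l)])"
    by (rule tickI, rule QC2[OF r1 r2]) (simp_all only: act_stay map2_act_stay)
  have 7: "ticks_within M (l + i) (QB b, W, (?C, length (?u @ [Aux 2]) + l), (hmark i, l), ts[1 := (f, l)])
     (QB b, W, (?C, length (?u @ [Aux 2]) + l), (hmark i, i), ts[1 := (f, i)])"
    by (rule tick_QB[OF len]) simp_all
  have h: "read (hmark i, i) \<in> {One, Zero}" unfolding read.simps by (simp only: hmark_vals)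
  have 8: "tick M (QB b, W, (?C, length (?u @ [Aux 2]) + l), (hmark i, i), ts[1 := (f, i)])
     (Run (if b then yes M else no M), W, (?C, length (?u @ [Aux 2]) + l), (cont [Sep], i), ts)"
    unfolding ts1 by (rule tickI, rule QB2[OF h]) (simp_all only: act_stay map2_act_stay, simp add: hmark_vals)
  note chain = ticks_within_trans[OF ticks_within_1[OF 1] ticks_within_trans[OF 2 ticks_within_trans[OF 3 ticks_within_trans[OF ticks_within_1[OF 4]
    ticks_within_trans[OF 5 ticks_within_trans[OF ticks_within_1[OF 6] ticks_within_trans[OF 7 ticks_within_1[OF 8] HOL.refl] HOL.refl] HOL.refl] HOL.refl] HOL.refl] HOL.refl] HOL.refl]
  show ?thesis
    by (rule exI[of _ "length (?u @ [Aux 2]) + l"], rule conjI, simp add: N, rule ticks_within_mono[OF chain], simp add: N)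
qed

text \<open>An ordinary step costs one tick and a query the amount of \<open>tick_query\<close>; the
  last tick enters \<open>Acc\<close>. The query head advances by at most one cell per step, so
  position plus remaining steps never grows and \<open>D\<close> bounds all positions. The table
  agrees with the oracle on the queries asked, so a lookup continues the given run. The position
  \<open>p\<close> is arbitrary because each query leaves the table head elsewhere.\<close>

lemma tick_run:
  assumes "oracle_run M Q c n qs c''" and M: "wf_oracle_tm M"
    and fin: "oracle_halted M c''" "fst c'' \<noteq> accept M"
    and es: "\<And>w. w \<in> set qs \<Longrightarrow> \<exists>y b. w = enc_inst y \<and> (y, b) \<in> set es \<and> (b \<longleftrightarrow> w \<in> Q)"
    and len: "length (snd c) = tapes M" and blank: "finite {k. fst (snd c ! 1) k \<noteq> Blank}"
    and D: "snd (snd c ! 1) + n \<le> D" and p: "p \<le> length (table es)"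
  shows "\<exists>b. fst b = Acc \<and> ticks_within M (n * (3 * length (table es) + 2 * D + 5) + 1)
    (Run (fst c), W, (cont (table es), p), (cont [Sep], snd (snd c ! 1)), snd c) b"
  using assms(1) fin es len blank D p
proof (induction arbitrary: p rule: oracle_run.induct)
  case (refl c)
  obtain q ts where c: "c = (q, ts)" by (cases c)
  from refl have "q \<noteq> query M" "\<And>q' a. (q, map read ts, q', a) \<notin> trans M" "q \<noteq> accept M"
    by (auto simp: oracle_halted_def step.simps c)
  then have "tick M (Run q, W, (cont (table es), p), (cont [Sep], snd (ts ! 1)), ts)
      (Acc, W, (cont (table es), p), (cont [Sep], snd (ts ! 1)), ts)"
    by (intro tickI[OF Run_halt]) (simp_all only: act_stay map2_act_stay simp_thms)
  from ticks_within_1[OF this] show ?case unfolding c fst_conv snd_conv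
    by (intro exI[of _ "(Acc, W, (cont (table es), p), (cont [Sep], snd (ts ! 1)), ts)"] conjI)
      (simp, erule ticks_within_mono, simp)
next
  case (compute c c' n qs c'')
  obtain q ts where c: "c = (q, ts)" by (cases c)
  obtain q' ts' where c': "c' = (q', ts')" by (cases c')
  have k: "tapes M \<ge> 2" using M by (simp add: wf_oracle_tm_def)
  from compute obtain a where a: "(q, map read ts, q', a) \<in> trans M" "ts' = map2 act a ts"
    by (auto simp: c c' step.simps)
  have l: "length a = tapes M" "length ts = tapes M"
    using a(1) M compute.prems by (auto simp: wf_oracle_tm_def wf_tm_def c)
  then have ts1: "ts' ! 1 = act (a ! 1) (ts ! 1)" using k by (simp add: a)
  have t: "tick M (Run q, W, (cont (table es), p), (cont [Sep], snd (ts ! 1)), ts)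
      (Run q', W, (cont (table es), p), (cont [Sep], snd (ts' ! 1)), ts')"
  proof (rule tickI[OF Run_step])
    show "q \<noteq> query M" using compute by (simp add: c)
    show "(q, map read ts, q', a) \<in> trans M" by (rule a)
    show "(cont [Sep], snd (ts' ! 1)) =
        act (read (cont [Sep], snd (ts ! 1)), snd (a ! 1)) (cont [Sep], snd (ts ! 1))"
      unfolding ts1 by (cases "ts ! 1"; cases "a ! 1") simp
  qed (simp_all only: act_stay a)
  have "\<exists>b. fst b = Acc \<and> ticks_within M (n * (3 * length (table es) + 2 * D + 5) + 1)
    (Run (fst c'), W, (cont (table es), p), (cont [Sep], snd (snd c' ! 1)), snd c') b"
  proof (rule compute.IH)
    show "length (snd c') = tapes M" using l by (simp add: c' a)
    have "{k. fst (ts' ! 1) k \<noteq> Blank} \<subseteq> insert (snd (ts ! 1)) {k. fst (ts ! 1) k \<noteq> Blank}"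
      unfolding ts1 by (cases "ts ! 1"; cases "a ! 1") auto
    then show "finite {k. fst (snd c' ! 1) k \<noteq> Blank}"
      using compute.prems unfolding c c' by (auto intro: finite_subset)
    have "snd (ts' ! 1) \<le> Suc (snd (ts ! 1))"
      unfolding ts1 by (cases "ts ! 1"; cases "a ! 1"; cases "snd (a ! 1)") auto
    then show "snd (snd c' ! 1) + n \<le> D" using compute.prems by (simp add: c c')
  qed (use compute.prems in auto)
  then obtain b where b: "fst b = Acc" "ticks_within M (n * (3 * length (table es) + 2 * D + 5) + 1)
    (Run q', W, (cont (table es), p), (cont [Sep], snd (ts' ! 1)), ts') b"
    by (auto simp: c')
  from ticks_within_trans[OF ticks_within_1[OF t] b(2) HOL.refl] b(1) show ?case
    unfolding c fst_conv snd_conv by (intro exI[of _ b] conjI) (assumption, erule ticks_within_mono, simp)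
next
  case (ask w ts n qs c'')
  have k: "tapes M \<ge> 2" using M by (simp add: wf_oracle_tm_def)
  obtain y b where y: "w = enc_inst y" "(y, b) \<in> set es" "b \<longleftrightarrow> w \<in> Q"
    using ask.prems(3)[of w] by auto
  obtain f i where ts: "ts ! 1 = (f, i)" by (cases "ts ! 1")
  have fin: "finite {k. f k \<noteq> Blank}" using ask.prems ts by simp
  have bl: "\<exists>k. f k = Blank"
  proof (rule ccontr)
    assume "\<not> (\<exists>k. f k = Blank)"
    then have "{k. f k \<noteq> Blank} = UNIV" by auto
    with fin show False by simp
  qed
  have D: "i + Suc n \<le> D" using ask.prems ts by simp
  obtain p' where p': "p' \<le> length (table es)" "ticks_within M (3 * length (table es) + 2 * i + 5)
    (Run (query M), W, (cont (table es), p), (cont [Sep], i), ts)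
    (Run (if b then yes M else no M), W, (cont (table es), p'), (cont [Sep], i), ts)"
    using tick_query[OF _ ts _ bl y(2) \<open>p \<le> length (table es)\<close>, of M W] ask y(1) ts k by auto
  have "\<exists>d. fst d = Acc \<and> ticks_within M (n * (3 * length (table es) + 2 * D + 5) + 1)
    (Run (if b then yes M else no M), W, (cont (table es), p'), (cont [Sep], i), ts) d"
    using ask.IH[of p'] ask.prems p'(1) D y(3) ts by simp
  then obtain d where d: "fst d = Acc" "ticks_within M (n * (3 * length (table es) + 2 * D + 5) + 1)
    (Run (if b then yes M else no M), W, (cont (table es), p'), (cont [Sep], i), ts) d" by blast
  have "ticks_within M (Suc n * (3 * length (table es) + 2 * D + 5) + 1)
    (Run (query M), W, (cont (table es), p), (cont [Sep], i), ts) d"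
    by (rule ticks_within_mono[OF ticks_within_trans[OF p'(2) d(2) HOL.refl]]) (use D in simp)
  with d(1) show ?case unfolding fst_conv snd_conv ts by blast
qed

text \<open>The query head starts at cell 0, so \<open>n\<close> itself can serve as the bound
  \<open>D\<close>. The constant 6 collects 2 for rewinding \<open>W\<close>, 2 for the guess, 1 for
  the second rewinding and 1 for entering \<open>Acc\<close>.\<close>

lemma ticks_accepting:
  assumes M: "wf_oracle_tm M" and x: "x \<in> set xs"
    and run: "oracle_run M Q (init M (enc_seq xs)) n qs c" "oracle_halted M c" "fst c \<noteq> accept M"
    and es: "\<And>w. w \<in> set qs \<Longrightarrow> \<exists>y b. w = enc_inst y \<and> (y, b) \<in> set es \<and> (b \<longleftrightarrow> w \<in> Q)"
  shows "\<exists>b. fst b = Acc \<and>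
    ticks_within M (length x + 2 * length (enc_seq xs) + n * (3 * length (table es) + 2 * n + 5) + 6) (loaded M x (table es)) b"
proof -
  let ?C = "(cont (table es), length (table es))" and ?w = "enc_seq xs"
  obtain k where k: "tapes M = Suc (Suc k)"
    using M by (cases "tapes M"; cases "tapes M - 1") (auto simp: wf_oracle_tm_def)
  have 1: "ticks_within M (length x + 2) (loaded M x (table es)) (guess_config M (G False True) (cont (Sep # bits x), Suc 0) ?C [] 0)"
    using tick_rewind_word[of M "Suc (length x)" x ?C "(cont [Sep], 0)" "replicate (tapes M) (cont [], 0)"]
    by (simp add: loaded_def guess_config_def k)
  obtain i where 2: "ticks_within M (length ?w + 2) (guess_config M (G False True) (cont (Sep # bits x), Suc 0) ?C [] 0)
    (guess_config M RM (cont (Sep # bits x), i) ?C ?w (length ?w))"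
    using guess_guess[OF x] by blast
  let ?W = "(cont (Sep # bits x), i)"
  have 3: "ticks_within M (length ?w + 1) (guess_config M RM ?W ?C ?w (length ?w)) (guess_config M (Run (start M)) ?W ?C ?w 0)"
    using guess_rewind[of M "length ?w"] by simp
  have i: "init M ?w = (start M, (cont ?w, 0) # replicate (tapes M - 1) (cont [], 0))"
    by (simp add: init_def tape_of_cont)
  have i1: "snd (init M ?w) ! 1 = (cont [], 0)" by (simp add: i k)
  have g: "guess_config M (Run (start M)) ?W ?C ?w 0 =
      (Run (fst (init M ?w)), ?W, ?C, (cont [Sep], snd (snd (init M ?w) ! 1)), snd (init M ?w))"
    unfolding i1 by (simp add: guess_config_def i)
  have "\<exists>b. fst b = Acc \<and> ticks_within M (n * (3 * length (table es) + 2 * n + 5) + 1)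
      (guess_config M (Run (start M)) ?W ?C ?w 0) b"
    unfolding g by (rule tick_run[OF run(1) M run(2,3) es])
      (simp_all only: i1, simp_all add: i k cont_def)
  then obtain b where b: "fst b = Acc" "ticks_within M (n * (3 * length (table es) + 2 * n + 5) + 1)
      (guess_config M (Run (start M)) ?W ?C ?w 0) b" by blast
  from ticks_within_trans[OF 1 ticks_within_trans[OF 2 ticks_within_trans[OF 3 b(2) HOL.refl] HOL.refl] HOL.refl]
  have "ticks_within M (length x + 2 * length ?w + n * (3 * length (table es) + 2 * n + 5) + 6) (loaded M x (table es)) b"
    by (rule ticks_within_mono) simp
  with b(1) show ?thesis by blast
qed

lemma verifier_complete:
  assumes M: "wf_oracle_tm M" and x: "x \<in> set xs"
    and run: "oracle_run M Q (init M (enc_seq xs)) n qs c" "oracle_halted M c" "fst c \<noteq> accept M"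
    and es: "\<And>w. w \<in> set qs \<Longrightarrow> \<exists>y b. w = enc_inst y \<and> (y, b) \<in> set es \<and> (b \<longleftrightarrow> w \<in> Q)"
    and f: "\<And>i. i < length x + 2 * length (enc_seq xs) + n * (3 * length (table es) + 2 * n + 5) + 6 \<Longrightarrow> f (p + i) = One"
  shows "acc_from (verifier M) (with_input p f (loaded M x (table es)))"
proof -
  obtain b m where b: "fst b = Acc" "(tick M ^^ m) (loaded M x (table es)) b"
    and m: "m \<le> length x + 2 * length (enc_seq xs) + n * (3 * length (table es) + 2 * n + 5) + 6"
    using ticks_accepting[OF M x run es] unfolding ticks_within_def by blast
  have "(step (verifier M) ^^ m) (with_input p f (loaded M x (table es))) (with_input (p + m) f b)"
    by (rule ticks_steps[OF b(2) loaded_in_alphabet[OF set_table] M]) (use f m in auto)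
  then have "(step (verifier M))\<^sup>*\<^sup>* (with_input p f (loaded M x (table es))) (with_input (p + m) f b)"
    by (rule relpowp_imp_rtranclp)
  moreover have "\<not> step (verifier M) (with_input (p + m) f b) d" for d
  proof
    assume "step (verifier M) (with_input (p + m) f b) d"
    moreover have "\<not> loading (fst b)" by (auto simp: b(1) loading_def)
    ultimately obtain b' where "tick M b b'" using step_tick by blast
    then show False using b(1) by cases (auto dest: work_not_loading)
  qed
  moreover have "fst (with_input (p + m) f b) = accept (verifier M)"
    using b(1) by (cases b) (simp add: with_input_def verifier_def)
  ultimately show ?thesis unfolding acc_from_def by blast
qed

section \<open>Few query sets cover all negative instances\<close>

text \<open>Let \<open>B z\<close> be the set of all components of tuples with value
  \<open>z\<close>; a tuple xs has all its components in \<open>B (F xs)\<close>. If every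
  \<open>B z\<close> had fewer than |U|/2 elements, then |U|^t would be at most the sum of the |B
  z|^t over \<open>Y\<close>, hence less than 2^t (|U|/2)^t = |U|^t.\<close>

lemma cover_half:
  fixes F :: "'a list \<Rightarrow> 'b"
  assumes U: "finite U" "U \<noteq> {}" and Y: "finite Y" "card Y \<le> 2 ^ t" and t: "t \<ge> 1"
    and F: "\<And>xs. set xs \<subseteq> U \<Longrightarrow> length xs = t \<Longrightarrow> F xs \<in> Y"
  shows "\<exists>z \<in> Y. card U \<le> 2 * card (\<Union>xs \<in> {xs. set xs \<subseteq> U \<and> length xs = t \<and> F xs = z}. set xs)"
proof (rule ccontr)
  define B where "B z = (\<Union>xs \<in> {xs. set xs \<subseteq> U \<and> length xs = t \<and> F xs = z}. set xs)" for z
  assume "\<not> ?thesis"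
  then have small: "2 * card (B z) < card U" if "z \<in> Y" for z
    using that by (auto simp: B_def not_le)
  have fB: "finite (B z)" for z
    by (rule finite_subset[OF _ U(1)]) (auto simp: B_def)
  let ?T = "\<lambda>A. {xs. set xs \<subseteq> A \<and> length xs = t}"
  have Yne: "Y \<noteq> {}"
  proof -
    obtain u where "u \<in> U" using U(2) by blast
    then have "F (replicate t u) \<in> Y" by (intro F) auto
    then show ?thesis by blast
  qed
  have "?T U \<subseteq> (\<Union>z \<in> Y. ?T (B z))"
    using F by (force simp: B_def)
  then have "card (?T U) \<le> card (\<Union>z \<in> Y. ?T (B z))"
    using Y(1) fB by (intro card_mono finite_UN_I finite_lists_length_eq)
  also have "\<dots> \<le> (\<Sum>z \<in> Y. card (?T (B z)))"
    using Y(1) by (rule card_UN_le)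
  also have "\<dots> = (\<Sum>z \<in> Y. card (B z) ^ t)"
    using fB by (simp add: card_lists_length_eq)
  finally have "2 ^ t * card U ^ t \<le> 2 ^ t * (\<Sum>z \<in> Y. card (B z) ^ t)"
    using U(1) by (simp add: card_lists_length_eq)
  also have "\<dots> = (\<Sum>z \<in> Y. (2 * card (B z)) ^ t)"
    by (simp add: sum_distrib_left power_mult_distrib)
  also have "\<dots> < (\<Sum>z \<in> Y. card U ^ t)"
    using Y(1) Yne small t by (intro sum_strict_mono power_strict_mono) auto
  also have "\<dots> \<le> 2 ^ t * card U ^ t"
    using Y(2) by simp
  finally show False by simp
qed

text \<open>Each use of \<open>cover_half\<close> removes at least half of the remaining words, so
  fewer than \<open>2 ^ m\<close> of them are exhausted in \<open>m\<close> rounds. The hypothesis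
  on \<open>F\<close> passes to subsets, which lets the induction replace \<open>U\<close> by the
  words left over.\<close>

lemma cover_tuples:
  fixes F :: "'a list \<Rightarrow> 'b"
  assumes "finite U" "card U < 2 ^ m" and Y: "finite Y" "card Y \<le> 2 ^ t" and t: "t \<ge> 1"
    and F: "\<And>xs. set xs \<subseteq> U \<Longrightarrow> length xs = t \<Longrightarrow> F xs \<in> Y"
  shows "\<exists>Z \<subseteq> Y. card Z \<le> m \<and> (\<forall>x \<in> U. \<exists>xs. set xs \<subseteq> U \<and> length xs = t \<and> x \<in> set xs \<and> F xs \<in> Z)"
  using assms(1,2) F
proof (induction m arbitrary: U)
  case 0
  then show ?case by (intro exI[of _ "{}"]) auto
next
  case (Suc m)
  show ?case
  proof (cases "U = {}")
    case True
    then show ?thesis by (intro exI[of _ "{}"]) auto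
  next
    case False
    define B where "B z = (\<Union>xs \<in> {xs. set xs \<subseteq> U \<and> length xs = t \<and> F xs = z}. set xs)" for z
    from cover_half[where F = F, OF Suc.prems(1) False Y t Suc.prems(3)] obtain z
      where z: "z \<in> Y" "card U \<le> 2 * card (B z)"
      unfolding B_def by blast
    have "B z \<subseteq> U" by (auto simp: B_def)
    then have "card (U - B z) < 2 ^ m"
      using Suc.prems(1,2) z(2) by (simp add: card_Diff_subset finite_subset card_mono)
    from Suc.IH[OF _ this] Suc.prems(1,3) obtain Z where Z: "Z \<subseteq> Y" "card Z \<le> m"
      "\<forall>x \<in> U - B z. \<exists>xs. set xs \<subseteq> U - B z \<and> length xs = t \<and> x \<in> set xs \<and> F xs \<in> Z"
      by blast
    have "card (insert z Z) \<le> Suc m"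
      using Z(1,2) Y(1) by (simp add: card_insert_if finite_subset)
    moreover have "\<exists>xs. set xs \<subseteq> U \<and> length xs = t \<and> x \<in> set xs \<and> F xs \<in> insert z Z" if "x \<in> U" for x
    proof (cases "x \<in> B z")
      case True
      then show ?thesis by (auto simp: B_def)
    next
      case False
      with Z(3) that show ?thesis by blast
    qed
    ultimately show ?thesis using z(1) Z(1) by (intro exI[of _ "insert z Z"]) auto
  qed
qed

text \<open>Total size without the summand \<open>c\<^sub>0\<close>. It bounds the true total size
  from below whatever \<open>c\<^sub>0\<close> is, so the counting is uniform in that
  constant.\<close>

definition weight :: "inst list \<Rightarrow> nat" where
  "weight ys = (\<Sum>y \<leftarrow> ys. length (fst y) + snd y)"

text \<open>If \<open>c\<^sub>0 = 0\<close>, the instance \<open>([], 0)\<close> has size \<open>0\<close> and may be asked any number of times, so it is not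
  counted; the table always contains it.\<close>

abbreviation proper :: "inst list \<Rightarrow> bool" where
  "proper ys \<equiv> ([], 0) \<notin> set ys"

lemma weight_simps [simp]: "weight [] = 0" "weight (y # ys) = length (fst y) + snd y + weight ys"
  by (simp_all add: weight_def)

lemma weight_filter: "weight (filter (\<lambda>y. y \<noteq> ([], 0)) ys) = weight ys"
  by (induction ys) auto

section \<open>Counting query lists of small weight by an injective code\<close>

lemma inj_bits: "bits x = bits y \<Longrightarrow> x = y"
proof (induction x arbitrary: y)
  case Nil
  then show ?case by (cases y) auto
next
  case (Cons b x)
  then show ?case by (cases y) (auto split: if_splits)
qed

lemma inj_enc_inst: "enc_inst y = enc_inst z \<Longrightarrow> y = z"
proof -
  assume "enc_inst y = enc_inst z"
  moreover obtain u i v j where yz: "y = (u, i)" "z = (v, j)" by (cases y; cases z)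
  ultimately have eq: "bits u @ Sep # replicate i One = bits v @ Sep # replicate j One"
    by (simp add: enc_inst_def)
  have "takeWhile (\<lambda>s. s \<noteq> Sep) (bits x @ Sep # r) = bits x" for x r by (induction x) auto
  with arg_cong[OF eq, of "takeWhile (\<lambda>s. s \<noteq> Sep)"] have "bits u = bits v" by simp
  with eq have "u = v" "replicate i One = replicate j One" by (auto dest: inj_bits)
  then show "y = z" using yz by (metis length_replicate)
qed

definition spell :: "inst list \<Rightarrow> sym list" where
  "spell ys = concat (map (\<lambda>y. enc_inst y @ [Aux 0]) ys)"

lemma inj_spell: "spell ys = spell zs \<Longrightarrow> ys = zs"
proof (induction ys arbitrary: zs)
  case Nil
  then show ?case by (cases zs) (auto simp: spell_def)
next
  case (Cons y ys)
  then obtain z zs' where zs: "zs = z # zs'" by (cases zs) (auto simp: spell_def)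
  with Cons.prems have "enc_inst y @ Aux 0 # spell ys = enc_inst z @ Aux 0 # spell zs'"
    by (simp add: spell_def)
  from append_Aux_eq[OF this set_enc_inst set_enc_inst] Cons.IH show ?case
    by (auto simp: zs dest: inj_enc_inst)
qed

lemma length_enc_inst: "length (enc_inst y) = length (fst y) + snd y + 1"
  by (cases y) (simp add: enc_inst_def)

text \<open>Each instance costs two symbols beyond its weight, \<open>Sep\<close> and the terminator
  \<open>Aux 0\<close>. Properness makes the weight of each at least 1, so the code is at most three
  times as long.\<close>

lemma length_spell: "proper ys \<Longrightarrow> length (spell ys) \<le> 3 * weight ys"
proof (induction ys)
  case (Cons y ys)
  have "length (fst y) + snd y \<ge> 1" using Cons.prems by (cases y; cases "fst y") auto
  with Cons show ?case by (auto simp: spell_def length_enc_inst)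
qed (simp add: spell_def)

lemma set_spell: "set (spell ys) \<subseteq> {Zero, One, Sep, Aux 0}"
  by (auto simp: spell_def dest!: subsetD[OF set_enc_inst])

text \<open>Bounds the number of words of length at most \<open>m\<close> over four letters; base 8
  absorbs the sum over the lengths and is a power of 2.\<close>

lemma sum_power4_le: "(\<Sum>i \<le> m. 4 ^ i) \<le> (8 :: nat) ^ m"
proof (induction m)
  case (Suc m)
  have "(4 :: nat) ^ m \<le> 8 ^ m" by (rule power_mono) auto
  with Suc show ?case by simp
qed simp

text \<open>The factor 9 is 3 * 3: weight at most t/9 gives codes of length at most t/3 over four
  letters, and there are at most 8^(t/3) \<le> 2^t of these.\<close>

lemma card_light:
  fixes t :: nat
  defines "Y \<equiv> {ys. proper ys \<and> 9 * weight ys \<le> t}"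
  shows "finite Y" "card Y \<le> 2 ^ t"
proof -
  let ?W = "{w. set w \<subseteq> {Zero, One, Sep, Aux 0} \<and> length w \<le> t div 3}"
  have inj: "inj_on spell Y" by (auto intro: inj_onI dest: inj_spell)
  have sub: "spell ` Y \<subseteq> ?W"
  proof safe
    fix ys s assume "ys \<in> Y" 
    then have "length (spell ys) \<le> 3 * weight ys" "9 * weight ys \<le> t"
      by (auto simp: Y_def length_spell)
    then show "length (spell ys) \<le> t div 3" by simp
  qed (use set_spell in auto)
  have fin: "finite ?W" by (rule finite_lists_length_le) simp
  show "finite Y" using finite_imageD[OF finite_subset[OF sub fin] inj] .
  have "card Y \<le> card ?W" using card_inj_on_le[OF inj sub fin] .
  also have "card ?W = (\<Sum>i \<le> t div 3. card {Zero, One, Sep, Aux 0} ^ i)"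
    by (rule card_lists_length_le) simp
  also have "card {Zero, One, Sep, Aux 0} = 4" by simp
  also have "(\<Sum>i \<le> t div 3. 4 ^ i) \<le> (8 :: nat) ^ (t div 3)" by (rule sum_power4_le)
  also have "\<dots> = 2 ^ (3 * (t div 3))" by (simp add: power_mult)
  also have "\<dots> \<le> 2 ^ t" by (rule power_increasing) auto
  finally show "card Y \<le> 2 ^ t" .
qed

text \<open>Since K \<epsilon> \<ge> 1, t^\<epsilon> is at least 9B + 1, so 9B t^(1 - \<epsilon>)
  \<le> t. The added 1 keeps the base at least 1, which makes its powers monotone in the exponent
  and \<open>t\<close> positive also for \<open>B = 0\<close>.\<close>

lemma tuple_length_bound:
  fixes w B K :: nat and \<epsilon> :: real
  assumes K: "real K * \<epsilon> \<ge> 1" and t: "t = (9 * B + 1) ^ K"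
    and w: "real w \<le> real t powr (1 - \<epsilon>) * real B"
  shows "9 * w \<le> t"
proof -
  let ?a = "real (9 * B + 1)"
  have t0: "real t > 0" by (simp add: t)
  have tK: "real t = ?a powr real K" unfolding t by (subst powr_realpow) simp_all
  have "real (9 * B) \<le> ?a powr 1" by simp
  also have "\<dots> \<le> ?a powr (real K * \<epsilon>)" using K by (intro powr_mono) simp_all
  also have "\<dots> = real t powr \<epsilon>" by (simp add: tK powr_powr)
  finally have "real (9 * B) \<le> real t powr \<epsilon>" .
  then have "real t powr (1 - \<epsilon>) * real (9 * B) \<le> real t powr (1 - \<epsilon>) * real t powr \<epsilon>"
    by (intro mult_left_mono) simp_all
  also have "\<dots> = real t" using t0 by (simp add: powr_add[symmetric])
  finally have "real (9 * w) \<le> real t" using w by simp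
  then show ?thesis by linarith
qed

text \<open>Beyond its weight, which is at least 1, an entry has three symbols: the opening
  \<open>Aux 2\<close>, \<open>Sep\<close> and the answer.\<close>

lemma length_table:
  assumes "\<And>y. fst (g y) = y"
  shows "proper ys \<Longrightarrow> length (table (map g ys)) \<le> 4 * weight ys"
proof (induction ys)
  case (Cons y ys)
  have "length (fst y) + snd y \<ge> 1" using Cons.prems by (cases y; cases "fst y") auto
  moreover obtain b where "g y = (y, b)" using assms[of y] by (cases "g y") auto
  ultimately show ?case using Cons by (auto simp: table_def entry_def length_enc_inst)
qed (simp add: table_def)

lemma weight_append [simp]: "weight (ys @ zs) = weight ys + weight zs"
  by (simp add: weight_def)

lemma weight_concat: "(\<And>ys. ys \<in> set yss \<Longrightarrow> weight ys \<le> k) \<Longrightarrow> weight (concat yss) \<le> length yss * k"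
proof (induction yss)
  case (Cons ys yss)
  then show ?case using Cons.prems[of ys] by (simp add: add_mono)
qed simp

lemma length_code: "s \<in> set csyms \<Longrightarrow> length (code s) \<le> 6"
  using ix_csyms[of s] by simp

lemma length_codes: "set c \<subseteq> set csyms \<Longrightarrow> length (concat (map code c)) \<le> 6 * length c"
proof (induction c)
  case (Cons s c)
  then show ?case using length_code[of s] by auto
qed simp

lemma length_enc_seq: "(\<And>x. x \<in> set xs \<Longrightarrow> length x = n) \<Longrightarrow> length (enc_seq xs) = length xs * (n + 1)"
  by (induction xs) (auto simp: enc_seq_def)

section \<open>The advice\<close>

definition distills ::
  "(nat, 'm) oracle_tm_scheme \<Rightarrow> problem \<Rightarrow> parameterized_problem \<Rightarrow> nat poly \<Rightarrow> bool list list \<Rightarrow>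
    nat \<Rightarrow> inst list \<Rightarrow> nat config \<Rightarrow> bool" where
  "distills M L R time xs n ys c \<longleftrightarrow>
    oracle_run M (enc_inst ` R) (init M (enc_seq xs)) n (map enc_inst ys) c \<and> oracle_halted M c \<and>
    n \<le> poly time (length (enc_seq xs)) \<and> (fst c = accept M \<longleftrightarrow> (\<exists>x \<in> set xs. x \<in> L))"

lemma advice_table:
  fixes b :: "nat poly" and K n :: nat
  defines "t \<equiv> (9 * poly b n + 1) ^ K"
  assumes K: "real K * \<epsilon> \<ge> 1"
    and D: "\<And>xs. xs \<noteq> [] \<Longrightarrow> \<exists>k ys c. distills M L R time xs k ys c \<and>
      real (weight ys) \<le> real (length xs) powr (1 - \<epsilon>) * real (poly b (Max (length ` set xs)))"
  shows "\<exists>es. (\<forall>(y, a) \<in> set es. a \<longleftrightarrow> y \<in> R) \<and> length (table es) \<le> 3 + (n + 1) * t \<and>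
    (\<forall>x. length x = n \<longrightarrow> x \<notin> L \<longrightarrow> (\<exists>xs k ys c. x \<in> set xs \<and> length (enc_seq xs) = t * (n + 1) \<and>
      distills M L R time xs k ys c \<and> fst c \<noteq> accept M \<and> set ys \<subseteq> fst ` set es))"
proof -
  define U where "U = {x. length x = n \<and> x \<notin> L}"
  define Y where "Y = {ys. proper ys \<and> 9 * weight ys \<le> t}"
  have t1: "t \<ge> 1" by (simp add: t_def)
  obtain k ys c where D': "distills M L R time xs (k xs) (ys xs) (c xs)"
    "real (weight (ys xs)) \<le> real (length xs) powr (1 - \<epsilon>) * real (poly b (Max (length ` set xs)))"
    if "xs \<noteq> []" for xs
    using D by metis
  define F where "F xs = filter (\<lambda>y. y \<noteq> ([], 0)) (ys xs)" for xs
  have "finite {x :: bool list. length x = n}" "card {x :: bool list. length x = n} = 2 ^ n"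
    using finite_lists_length_eq[of "UNIV :: bool set" n] card_lists_length_eq[of "UNIV :: bool set" n]
    by simp_all
  then have "finite U" "card U \<le> 2 ^ n"
    using card_mono[of "{x :: bool list. length x = n}" U] by (auto simp: U_def intro: finite_subset)
  \<comment> \<open>Strictness is what \<open>cover_tuples\<close> asks for: \<open>2 ^ n\<close>
    words may remain, so \<open>n + 1\<close> rounds are used.\<close>
  then have U: "finite U" "card U < 2 ^ (n + 1)" using le_less_trans[of "card U" "2 ^ n" "2 ^ (n + 1)"] by simp_all
  have FY: "F xs \<in> Y" if xs: "set xs \<subseteq> U" "length xs = t" for xs
  proof -
    have ne: "xs \<noteq> []" using xs t1 by auto
    have "length y = n" if "y \<in> set xs" for y using xs(1) that by (auto simp: U_def)
    \<comment> \<open>All components have length \<open>n\<close>, so the maximum in the size bound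
      is \<open>n\<close>; this is why each length gets its own table.\<close>
    then have "length ` set xs = {n}" using ne by (cases xs) auto
    with D'(2)[OF ne] xs have "real (weight (ys xs)) \<le> real t powr (1 - \<epsilon>) * real (poly b n)" by simp
    from tuple_length_bound[OF K t_def[THEN meta_eq_to_obj_eq] this] show ?thesis
      by (simp add: F_def Y_def weight_filter)
  qed
  from cover_tuples[where F = F, OF U card_light[of t, folded Y_def] t1 FY]
  obtain Z where Z: "Z \<subseteq> Y" "card Z \<le> n + 1"
    "\<forall>x \<in> U. \<exists>xs. set xs \<subseteq> U \<and> length xs = t \<and> x \<in> set xs \<and> F xs \<in> Z" by blast
  have "finite Z" by (rule finite_subset[OF Z(1) card_light(1)[of t, folded Y_def]])
  then obtain zss where zss: "set zss = Z" "length zss \<le> n + 1"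
    using finite_distinct_list[of Z] Z(2) by (auto simp: distinct_card)
  define es where "es = map (\<lambda>y. (y, y \<in> R)) (([], 0) # concat zss)"
  have w: "weight zs \<le> t div 9" "proper zs" if "zs \<in> Z" for zs
    using that Z(1) by (auto simp: Y_def)
  have "length (table (map (\<lambda>y. (y, y \<in> R)) (concat zss))) \<le> 4 * weight (concat zss)"
    using w(2) zss(1) by (intro length_table) auto
  also have "\<dots> \<le> 4 * (length zss * (t div 9))"
    using w(1) zss(1) by (intro mult_le_mono weight_concat) auto
  also have "\<dots> = length zss * (4 * (t div 9))" by simp
  also have "\<dots> \<le> (n + 1) * t" using zss(2) by (intro mult_le_mono) simp_all
  \<comment> \<open>The summand 3 is the entry of \<open>([], 0)\<close>: \<open>Aux 2\<close>,
    \<open>Sep\<close> and the answer.\<close>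
  finally have len: "length (table es) \<le> 3 + (n + 1) * t"
    by (simp add: es_def table_def entry_def length_enc_inst)
  have "\<exists>xs k ys c. x \<in> set xs \<and> length (enc_seq xs) = t * (n + 1) \<and>
      distills M L R time xs k ys c \<and> fst c \<noteq> accept M \<and> set ys \<subseteq> fst ` set es"
    if x: "length x = n" "x \<notin> L" for x
  proof -
    have "x \<in> U" using x by (simp add: U_def)
    with Z(3) obtain xs where xs: "set xs \<subseteq> U" "length xs = t" "x \<in> set xs" "F xs \<in> Z" by blast
    have ne: "xs \<noteq> []" using xs by auto
    have "length (enc_seq xs) = t * (n + 1)"
      using length_enc_seq[of xs n] xs by (auto simp: U_def)
    moreover have "fst (c xs) \<noteq> accept M"
      using D'(1)[OF ne] xs(1) by (auto simp: distills_def U_def)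
    moreover have "set (ys xs) \<subseteq> fst ` set es"
    proof
      fix y assume "y \<in> set (ys xs)"
      then have "y = ([], 0) \<or> y \<in> set (F xs)" by (auto simp: F_def)
      then show "y \<in> fst ` set es" using xs(4) zss(1) by (force simp: es_def)
    qed
    ultimately show ?thesis using D'(1)[OF ne] xs(3) by blast
  qed
  moreover have "\<forall>(y, a) \<in> set es. a \<longleftrightarrow> y \<in> R" by (auto simp: es_def)
  ultimately show ?thesis using len by blast
qed

theorem theorem9:
  fixes L :: problem and R :: parameterized_problem and c\<^sub>0 :: nat
  assumes "\<exists>M :: nat oracle_tm. oracle_or_distillation c\<^sub>0 M L R"
  shows "L \<in> slash_poly coNP"
proof -
  obtain M :: "nat oracle_tm" and \<epsilon> :: real and time b :: "nat poly"
    where M: "wf_oracle_tm M" "deterministic M" and \<epsilon>: "\<epsilon> > 0"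
    and dist: "\<And>xs. xs \<noteq> [] \<Longrightarrow> \<exists>n ys c.
        oracle_run M (enc_inst ` R) (init M (enc_seq xs)) n (map enc_inst ys) c \<and>
        oracle_halted M c \<and>
        n \<le> poly time (length (enc_seq xs)) \<and>
        real (\<Sum>y\<leftarrow>ys. inst_size c\<^sub>0 y)
          \<le> real (length xs) powr (1 - \<epsilon>) * real (poly b (Max (length ` set xs))) \<and>
        (fst c = accept M \<longleftrightarrow> (\<exists>x \<in> set xs. x \<in> L))"
    using assms unfolding oracle_or_distillation_def by blast
  have weight: "weight ys \<le> (\<Sum>y\<leftarrow>ys. inst_size c\<^sub>0 y)" for ys
    unfolding weight_def by (intro sum_list_mono) (auto simp: inst_size_def)
  have D: "\<exists>k ys c. distills M L R time xs k ys c \<and>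
      real (weight ys) \<le> real (length xs) powr (1 - \<epsilon>) * real (poly b (Max (length ` set xs)))"
    if "xs \<noteq> []" for xs
    using dist[OF that] weight unfolding distills_def by (meson of_nat_le_iff order_trans)
  obtain K :: nat where "1 / \<epsilon> \<le> real K" using real_arch_simple by blast
  then have K: "real K * \<epsilon> \<ge> 1" using \<epsilon> by (simp add: field_simps)
  define t where "t n = (9 * poly b n + 1) ^ K" for n
  obtain es where es: "\<And>n y a. (y, a) \<in> set (es n) \<Longrightarrow> a \<longleftrightarrow> y \<in> R"
    "\<And>n. length (table (es n)) \<le> 3 + (n + 1) * t n"
    "\<And>x. x \<notin> L \<Longrightarrow> \<exists>xs k ys c. x \<in> set xs \<and> length (enc_seq xs) = t (length x) * (length x + 1) \<and>
      distills M L R time xs k ys c \<and> fst c \<noteq> accept M \<and> set ys \<subseteq> fst ` set (es (length x))"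
  proof -
    have "\<forall>n. \<exists>es. (\<forall>(y, a) \<in> set es. a \<longleftrightarrow> y \<in> R) \<and> length (table es) \<le> 3 + (n + 1) * t n \<and>
      (\<forall>x. length x = n \<longrightarrow> x \<notin> L \<longrightarrow> (\<exists>xs k ys c. x \<in> set xs \<and> length (enc_seq xs) = t n * (n + 1) \<and>
        distills M L R time xs k ys c \<and> fst c \<noteq> accept M \<and> set ys \<subseteq> fst ` set es))"
      unfolding t_def by (intro allI advice_table[OF K D])
    from choice[OF this] obtain es where es: "\<And>n. (\<forall>(y, a) \<in> set (es n). a \<longleftrightarrow> y \<in> R) \<and>
      length (table (es n)) \<le> 3 + (n + 1) * t n \<and>
      (\<forall>x. length x = n \<longrightarrow> x \<notin> L \<longrightarrow> (\<exists>xs k ys c. x \<in> set xs \<and> length (enc_seq xs) = t n * (n + 1) \<and>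
        distills M L R time xs k ys c \<and> fst c \<noteq> accept M \<and> set ys \<subseteq> fst ` set (es n)))"
      by blast
    show ?thesis
    proof (rule that[of es])
      show "a \<longleftrightarrow> y \<in> R" if "(y, a) \<in> set (es n)" for n y a using es[of n] that by blast
    qed (use es in blast)+
  qed
  define N where "N n = 3 + (n + 1) * t n" for n
  define T where "T n = poly time (t n * (n + 1))" for n
  \<comment> \<open>The step bound of \<open>verifier_complete\<close>, with the length of the
    encoded tuple, the running time and the table size replaced by their bounds.\<close>
  define m where "m n = n + 2 * (t n * (n + 1)) + T n * (3 * N n + 2 * T n + 5) + 6" for n
  define adv where "adv n = advice (table (es n)) (m n)" for n
  define V where "V = relabel (to_nat :: vstate \<Rightarrow> nat) (verifier M)"
  have acc: "accepts V w \<longleftrightarrow> accepts (verifier M) w" for w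
    unfolding V_def by (rule accepts_relabel) simp
  have correct: "x \<notin> L \<longleftrightarrow> accepts V (bits (pair x (adv (length x))))" for x
  proof -
    let ?es = "es (length x)" and ?w = "bits (pair x (adv (length x)))"
    obtain p where p: "\<And>i. i < m (length x) \<Longrightarrow> cont ?w (p + i) = One"
      "accepts V ?w \<longleftrightarrow> acc_from (verifier M) (with_input p (cont ?w) (loaded M x (table ?es)))"
      using accepts_verifier[OF set_table[of ?es], of "m (length x)" x M] unfolding acc adv_def by blast
    have truth: "enc_inst y \<in> enc_inst ` R \<longleftrightarrow> a" if "(y, a) \<in> set ?es" for y a
      using es(1)[OF that] by (auto dest: inj_enc_inst)
    show ?thesis unfolding p(2)
    proof
      assume "x \<notin> L"
      from es(3)[OF this] obtain xs k ys c where xs: "x \<in> set xs"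
        "length (enc_seq xs) = t (length x) * (length x + 1)" "distills M L R time xs k ys c"
        "fst c \<noteq> accept M" "set ys \<subseteq> fst ` set ?es" by blast
      have k: "k \<le> T (length x)" using xs(2,3) by (simp add: distills_def T_def)
      have "length x + 2 * length (enc_seq xs) + k * (3 * length (table ?es) + 2 * k + 5) + 6 \<le> m (length x)"
        unfolding m_def xs(2) using k es(2)[of "length x", folded N_def]
        by (intro add_mono mult_mono) simp_all
      then have f: "cont ?w (p + i) = One"
        if "i < length x + 2 * length (enc_seq xs) + k * (3 * length (table ?es) + 2 * k + 5) + 6" for i
        using that p(1) by simp
      have q: "\<exists>y a. w = enc_inst y \<and> (y, a) \<in> set ?es \<and> (a \<longleftrightarrow> w \<in> enc_inst ` R)"
        if "w \<in> set (map enc_inst ys)" for w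
      proof -
        from that obtain y where y: "y \<in> set ys" "w = enc_inst y" by auto
        then obtain a where "(y, a) \<in> set ?es" using xs(5) by fastforce
        with truth[OF this] y(2) show ?thesis by blast
      qed
      from xs(3) have r: "oracle_run M (enc_inst ` R) (init M (enc_seq xs)) k (map enc_inst ys) c" "oracle_halted M c"
        by (simp_all add: distills_def)
      show "acc_from (verifier M) (with_input p (cont ?w) (loaded M x (table ?es)))"
        by (rule verifier_complete[OF M(1) xs(1) r xs(4) q]) (simp_all only: f)
    next
      assume a: "acc_from (verifier M) (with_input p (cont ?w) (loaded M x (table ?es)))"
      show "x \<notin> L"
      \<comment> \<open>The guessed sequence is arbitrary, so correctness of the distillation on all
        non-empty sequences enters here, not only on the tuples of the cover.\<close>
      proof (rule verifier_sound[OF M truth _ a])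
        fix xs assume "x \<in> set xs"
        then show "\<exists>c. (ostep M (enc_inst ` R))\<^sup>*\<^sup>* (init M (enc_seq xs)) c \<and> oracle_halted M c \<and>
            (x \<in> L \<longrightarrow> fst c = accept M)"
          using D[of xs] unfolding distills_def by (fastforce dest: oracle_run_ostep)
      qed
    qed
  qed
  \<comment> \<open>The verifier certifies \<open>x \<notin> L\<close>, so its language is the
    complement of \<open>A\<close>. The time polynomial \<open>[:0, 1:]\<close> is the identity, as
    each step consumes one input symbol.\<close>
  define A where "A = {w. \<not> accepts V (bits w)}"
  have "A \<in> coNP"
    unfolding coNP_def NP_def
  proof (intro CollectI exI conjI allI)
    show "wf_tm V" unfolding V_def using M(1) by (intro wf_relabel wf_verifier) (simp add: wf_oracle_tm_def)
    show "halts_within V (bits w) (poly [:0, 1:] (length w))" for w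
      unfolding V_def using verifier_halts[of M "bits w"] by (subst halts_within_relabel) simp_all
    show "w \<in> - A \<longleftrightarrow> accepts V (bits w)" for w by (simp add: A_def)
  qed
  \<comment> \<open>At most six bits per table symbol, seven bits for the end marker, and the
    padding.\<close>
  moreover have "\<forall>n. length (adv n) \<le> poly P n" if "\<And>n. poly P n = 6 * N n + 7 + m n" for P
  proof
    fix n
    have "length (concat (map code (table (es n)))) \<le> 6 * N n"
      by (rule order_trans[OF length_codes[OF set_table] mult_le_mono2[OF es(2)[of n, folded N_def]]])
    then show "length (adv n) \<le> poly P n" by (simp add: that adv_def advice_def)
  qed
  \<comment> \<open>The exponent \<open>K\<close> depends on \<epsilon> only, so \<open>t\<close>
    and everything built from it are polynomials in \<open>n\<close>.\<close>
  moreover have "\<exists>P. \<forall>n. poly P n = 6 * N n + 7 + m n"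
  proof -
    let ?n = "[:0, 1:] :: nat poly"
    let ?t = "([:9:] * b + 1) ^ K"
    let ?N = "[:3:] + (?n + 1) * ?t"
    let ?T = "pcompose time (?t * (?n + 1))"
    have "poly ([:6:] * ?N + [:7:] + (?n + [:2:] * (?t * (?n + 1)) + ?T * ([:3:] * ?N + [:2:] * ?T + [:5:]) + [:6:])) n =
        6 * N n + 7 + m n" for n
      by (simp add: N_def m_def T_def t_def poly_pcompose poly_power)
    then show ?thesis by blast
  qed
  moreover have "x \<in> L \<longleftrightarrow> pair x (adv (length x)) \<in> A" for x
    using correct[of x] by (auto simp: A_def)
  ultimately show ?thesis unfolding slash_poly_def by blast
qed

end
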